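(* Let $N=2$. With $\mathcal{A}_2$, $Q$, the subspaces $M_2$ (monotone operators) and $E_2$ ($Q$-exact operators) as defined in the context, set for $a,b\in\{1,2\}$ $$\mathcal{O}^a_b = \epsilon^{cd}\left[4\,\mathrm{Tr}(\bar\psi_c\phi_d\bar\phi^a\phi_b)-3\,\mathrm{Tr}(\bar\psi_c\phi_d)\,\mathrm{Tr}(\bar\phi^a\phi_b)\right]-\epsilon_{cd}\left[4\,\mathrm{Tr}(\psi^c\bar\phi^d\phi_b\bar\phi^a)-3\,\mathrm{Tr}(\psi^c\bar\phi^d)\,\mathrm{Tr}(\phi_b\bar\phi^a)\right]\in\mathcal{A}_2$$ and $T^c_d=\mathrm{Tr}(\bar\phi^c\phi_d)$. Then: (1) (Disallowed dressings) For all $b,d\in\{1,2\}$, $\;\epsilon_{ac}\left(\mathcal{O}^a_b T^c_d+\mathcal{O}^a_d T^c_b\right)\in M_2+E_2$; and for all $a,c\in\{1,2\}$, $\;\epsilon^{bd}\left(\mathcal{O}^a_b T^c_d+\mathcal{O}^c_b T^a_d\right)\in M_2+E_2$. (2) (Allowed dressings) $\epsilon_{ac}\epsilon^{bd}\,\mathcal{O}^a_b T^c_d\notin M_2+E_2$; and for all $a,b,c,d\in\{1,2\}$, the bi-triplet component $\mathcal{O}^{a}_{b}T^{c}_{d}+\mathcal{O}^{c}_{b}T^{a}_{d}+\mathcal{O}^{a}_{d}T^{c}_{b}+\mathcal{O}^{c}_{d}T^{a}_{b}\notin M_2+E_2$.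
   Context: Repeated flavour indices are summed over $\{1,2\}$; $\epsilon^{ab},\epsilon_{ab}$ are antisymmetric with $\epsilon^{12}=\epsilon_{12}=1$. Letters. Unbarred letters: bosons $\phi_a$, $D\phi_a$ and fermions $\psi^a$. Barred letters: bosons $\bar\phi^a$, $D\bar\phi^a$ and fermions $\bar\psi_a$ ($a\in\{1,2\}$). A single-trace word is a cyclic word $\mathrm{Tr}(X_1\bar X_1\cdots X_L\bar X_L)$, $L\ge1$, in which unbarred and barred letters alternate (it may equally be written starting with a barred letter), modulo cyclic rotation with the usual sign for moving fermionic letters past each other. Formal algebra. $\mathcal{A}_\infty$ is the free graded-commutative complex algebra generated by single-trace words (multi-trace operators with no relations other than supercyclicity). Algebra at finite $N$. $\mathcal{A}_N$ is the image of $\mathcal{A}_\infty$ under the evaluation homomorphism $\mathrm{ev}_N$ that replaces each unbarred and each barred letter by a generic $N\times N$ matrix whose entries are independent free generators of a graded-commutative algebra (even for bosons, odd for fermions), with $\mathrm{Tr}$ the matrix trace. The kernel $I_N$ of $\mathrm{ev}_N$ is the ideal of trace relations. Supercharge. $Q$ is the odd derivation (graded Leibniz rule inside words and on products of traces) determined by $Q\phi_a=0$, $Q\bar\phi^a=0$, $Q\psi^a=\epsilon^{bc}\phi_b\bar\phi^a\phi_c$, $Q\bar\psi_a=\epsilon_{bc}\bar\phi^b\phi_a\bar\phi^c$, $Q(D\phi_e)=\phi_e\Lambda-\tilde\Lambda\phi_e$, $Q(D\bar\phi^e)=\bar\phi^e\tilde\Lambda-\Lambda\bar\phi^e$, where $\Lambda=\epsilon^{ab}\bar\psi_a\phi_b-\epsilon_{ab}\bar\phi^a\psi^b$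 and $\tilde\Lambda=\epsilon_{ab}\psi^a\bar\phi^b-\epsilon^{ab}\phi_a\bar\psi_b$. It satisfies $Q^2=0$ and acts compatibly on $\mathcal{A}_\infty$ and on $\mathcal{A}_N$. Monotone and exact operators. $M_N=\mathrm{ev}_N(\ker(Q:\mathcal{A}_\infty\to\mathcal{A}_\infty))$ is the space of monotone operators, i.e. those having a representative that is $Q$-closed without using trace relations. $E_N=Q(\mathcal{A}_N)$ is the space of $Q$-exact operators. A $Q$-closed element of $\mathcal{A}_N$ outside $M_N+E_N$ represents a fortuitous cohomology class. The product of a fortuitous operator with $\mathrm{Tr}(\bar\phi^c\phi_d)$, suitably contracted, is called an allowed graviton dressing if it is not in $M_N+E_N$ and a disallowed one if it is. *)

theory Defs
  imports "HOL-Analysis.Analysis" "HOL-Library.Poly_Mapping" "HOL-Library.Set_Algebras"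
begin

section \<open>Free associative superalgebras\<close>

text \<open>
  The free associative complex algebra on a set of generators is the monoid algebra of the
  free monoid; lists need a copy because \<^class>\<open>monoid_add\<close> is the key class of
  the convolution product on \<^type>\<open>poly_mapping\<close>.
\<close>

datatype 'x word = Word (letters: "'x list")

instantiation word :: (type) monoid_add
begin
definition zero_word :: "'a word" where "zero_word = Word []"
definition plus_word :: "'a word \<Rightarrow> 'a word \<Rightarrow> 'a word"
  where "plus_word u v = Word (letters u @ letters v)"
instance by standard (simp_all add: zero_word_def plus_word_def)
end

type_synonym 'x free_alg = "'x word \<Rightarrow>\<^sub>0 complex"

definition mon :: "'x list \<Rightarrow> 'x free_alg" where "mon w = Poly_Mapping.single (Word w) 1"

abbreviation gen :: "'x \<Rightarrow> 'x free_alg" where "gen x \<equiv> mon [x]"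

definition cst :: "complex \<Rightarrow> 'x free_alg" where "cst c = Poly_Mapping.single 0 c"

text \<open>\<open>cst\<close> embeds the scalars, so \<open>lin_ext\<close> is the complex-linear extension from basis words.\<close>

definition lin_ext :: "('x list \<Rightarrow> 'y free_alg) \<Rightarrow> 'x free_alg \<Rightarrow> 'y free_alg" where
  "lin_ext g f = (\<Sum>w\<in>Poly_Mapping.keys f. cst (Poly_Mapping.lookup f w) * g (letters w))"

definition alg_hom :: "('x \<Rightarrow> 'y free_alg) \<Rightarrow> 'x free_alg \<Rightarrow> 'y free_alg" where
  "alg_hom h = lin_ext (\<lambda>w. prod_list (map h w))"

class graded =
  fixes is_odd :: "'a \<Rightarrow> bool"

definition koszul :: "bool \<Rightarrow> bool \<Rightarrow> 'a::ring_1" where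
  "koszul p q = (if p \<and> q then - 1 else 1)"

definition odd_word :: "'x::graded list \<Rightarrow> bool" where
  "odd_word w = odd (length (filter is_odd w))"

text \<open>The signed Leibniz rule for an odd derivation acting from the left.\<close>

fun der_word :: "('x::graded \<Rightarrow> 'x free_alg) \<Rightarrow> 'x list \<Rightarrow> 'x free_alg" where
  "der_word d [] = 0"
| "der_word d (x # w) = d x * mon w + koszul (is_odd x) True * gen x * der_word d w"

definition odd_der :: "('x::graded \<Rightarrow> 'x free_alg) \<Rightarrow> 'x free_alg \<Rightarrow> 'x free_alg" where
  "odd_der d = lin_ext (der_word d)"

definition homog :: "bool \<Rightarrow> 'x::graded free_alg \<Rightarrow> bool" where
  "homog p f \<longleftrightarrow> (\<forall>w. Poly_Mapping.lookup f (Word w) \<noteq> 0 \<longrightarrow> odd_word w = p)"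

definition grade_inv :: "'x::graded free_alg \<Rightarrow> 'x free_alg" where
  "grade_inv = lin_ext (\<lambda>w. koszul (odd_word w) True * mon w)"

subsection \<open>Basic properties\<close>

lemma mon_Nil [simp]: "mon [] = 1"
  by (simp add: mon_def flip: zero_word_def)

lemma mon_mult: "mon u * mon v = mon (u @ v)"
  by (simp add: mon_def mult_single plus_word_def)

lemma cst_0 [simp]: "cst 0 = 0" and cst_1 [simp]: "cst 1 = 1"
  and cst_add: "cst (c + d) = cst c + cst d" and cst_mult: "cst (c * d) = cst c * cst d"
  by (simp_all add: cst_def single_add mult_single)

lemma cst_mon: "cst c * mon w = Poly_Mapping.single (Word w) c"
  by (simp add: cst_def mon_def mult_single)

lemma poly_mapping_sum_monomials:
  "(\<Sum>w\<in>Poly_Mapping.keys f. Poly_Mapping.single w (Poly_Mapping.lookup f w)) = f"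
  by (rule poly_mapping_eqI)
     (simp add: lookup_sum lookup_single when_def sum.delta' in_keys_iff)

lemma free_alg_induct [case_names mon add]:
  assumes "\<And>c w. P (cst c * mon w)" and "\<And>f g. P f \<Longrightarrow> P g \<Longrightarrow> P (f + g)"
  shows "P f"
proof -
  have z: "P 0" using assms(1)[of 0] by simp
  have s: "P (Poly_Mapping.single w c)" for w c
    using assms(1)[of c "letters w"] by (simp add: cst_mon)
  have "P (\<Sum>w\<in>S. Poly_Mapping.single w (Poly_Mapping.lookup f w))" if "finite S" for S
    using that by (induction S) (auto simp: z s assms(2))
  from this[OF finite_keys[of f]] show ?thesis by (simp add: poly_mapping_sum_monomials)
qed

lemma cst_comm: "cst c * f = f * cst c"
proof (induction f rule: free_alg_induct)
  case (mon d w)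
  show ?case by (simp add: cst_mon) (simp add: cst_def mult_single mult.commute)
qed (simp add: algebra_simps)

lemma cst_left_comm: "f * (cst c * g) = cst c * (f * g)"
proof -
  have "f * (cst c * g) = f * cst c * g" by (simp only: mult.assoc)
  also have "\<dots> = cst c * (f * g)" by (simp only: cst_comm[of c f, symmetric] mult.assoc)
  finally show ?thesis .
qed

lemma cst_mon_mult: "cst c * mon u * (cst d * mon v) = cst c * (cst d * mon (u @ v))"
  by (simp only: mult.assoc cst_left_comm[of "mon u"] mon_mult)

lemma lin_ext_superset:
  assumes "finite S" "Poly_Mapping.keys f \<subseteq> S"
  shows "lin_ext g f = (\<Sum>w\<in>S. cst (Poly_Mapping.lookup f w) * g (letters w))"
  unfolding lin_ext_def
  by (rule sum.mono_neutral_left) (use assms in \<open>auto simp: in_keys_iff\<close>)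

lemma lin_ext_add: "lin_ext g (f + f') = lin_ext g f + lin_ext g f'"
proof -
  let ?S = "Poly_Mapping.keys f \<union> Poly_Mapping.keys f'"
  have "Poly_Mapping.keys (f + f') \<subseteq> ?S" by (rule keys_add)
  then show ?thesis
    by (simp add: lin_ext_superset[of ?S] lookup_add cst_add distrib_right sum.distrib)
qed

lemma lin_ext_0 [simp]: "lin_ext g 0 = 0"
  by (simp add: lin_ext_def)

lemma lin_ext_cst_mon: "lin_ext g (cst c * mon w) = cst c * g w"
  by (auto simp: cst_mon lin_ext_def)

lemma lin_ext_mon [simp]: "lin_ext g (mon w) = g w"
  using lin_ext_cst_mon[of g 1 w] by simp

lemma lin_ext_1 [simp]: "lin_ext g 1 = g []"
  using lin_ext_mon[of g "[]"] by (simp del: lin_ext_mon)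

lemma lin_ext_scale: "lin_ext g (cst c * f) = cst c * lin_ext g f"
proof (induction f rule: free_alg_induct)
  case (mon d w)
  show ?case by (simp add: lin_ext_cst_mon flip: mult.assoc cst_mult)
qed (simp add: distrib_left lin_ext_add)

lemma lin_ext_uminus: "lin_ext g (- f) = - lin_ext g f"
  using lin_ext_add[of g f "- f"] by (simp add: minus_unique)

lemma lin_ext_diff: "lin_ext g (f - f') = lin_ext g f - lin_ext g f'"
  using lin_ext_add[of g f "- f'"] by (simp add: lin_ext_uminus)

lemma lin_ext_sum: "lin_ext g (sum f S) = (\<Sum>x\<in>S. lin_ext g (f x))"
  by (induction S rule: infinite_finite_induct) (simp_all add: lin_ext_add)

lemma lin_ext_koszul: "lin_ext g (koszul p q * f) = koszul p q * lin_ext g f"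
  by (simp add: koszul_def lin_ext_uminus)

lemma koszul_comm: "koszul p q * x = x * (koszul p q :: 'a::ring_1)"
  by (simp add: koszul_def)

lemma odd_word_append: "odd_word (u @ v) = (odd_word u \<noteq> odd_word v)"
  by (auto simp: odd_word_def)

lemma odd_word_Nil [simp]: "\<not> odd_word []" and odd_word_sing [simp]: "odd_word [x] = is_odd x"
  by (simp_all add: odd_word_def)

lemma odd_word_Cons: "odd_word (x # w) = (is_odd x \<noteq> odd_word w)"
  using odd_word_append[of "[x]" w] by simp

lemma alg_hom_mult: "alg_hom h (f * g) = alg_hom h f * alg_hom h g"
proof (induction f rule: free_alg_induct)
  case (mon c w)
  show ?case
  proof (induction g rule: free_alg_induct)
    case (mon d v)
    show ?case
      unfolding alg_hom_def cst_mon_mult lin_ext_scale lin_ext_mon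
      by (simp add: mult.assoc cst_left_comm[of "prod_list (map h w)"])
  qed (simp add: alg_hom_def lin_ext_add distrib_left)
qed (simp add: alg_hom_def lin_ext_add distrib_right)

lemma der_word_append:
  "der_word d (u @ v) = der_word d u * mon v + koszul (odd_word u) True * mon u * der_word d v"
proof (induction u)
  case (Cons x u)
  have 1: "mon (x # u) = gen x * mon u" by (simp add: mon_mult)
  have 2: "mon (u @ v) = mon u * mon v" by (simp add: mon_mult)
  show ?case unfolding append_Cons der_word.simps Cons.IH 1 2
    by (simp add: koszul_def odd_word_Cons distrib_left distrib_right mult.assoc)
qed (simp add: koszul_def)

lemma odd_der_mult: "odd_der d (f * g) = odd_der d f * g + grade_inv f * odd_der d g"
proof (induction f rule: free_alg_induct)
  case (mon c w)
  show ?case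
  proof (induction g rule: free_alg_induct)
    case (mon e v)
    have 1: "cst c * x * (cst e * y) = cst c * (cst e * (x * y))" for x y :: "'a free_alg"
      by (simp only: mult.assoc cst_left_comm[of x])
    have "odd_der d (cst c * mon w * (cst e * mon v)) = cst c * (cst e * der_word d (w @ v))"
      by (simp add: cst_mon_mult odd_der_def lin_ext_scale)
    also have "\<dots> = cst c * der_word d w * (cst e * mon v)
        + cst c * (koszul (odd_word w) True * mon w) * (cst e * der_word d v)"
      by (simp only: 1 der_word_append distrib_left)
    finally show ?case by (simp add: odd_der_def grade_inv_def lin_ext_scale)
  qed (simp add: odd_der_def lin_ext_add distrib_left)
qed (simp add: odd_der_def grade_inv_def lin_ext_add distrib_right)

lemma odd_der_1: "odd_der d 1 = 0"
  by (simp add: odd_der_def)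

lemma odd_der_sum: "odd_der d (sum f S) = (\<Sum>x\<in>S. odd_der d (f x))"
  by (simp add: odd_der_def lin_ext_sum)

subsection \<open>Homogeneous elements\<close>

lemma homog_0 [simp]: "homog p 0"
  by (simp add: homog_def)

lemma homog_add: "homog p f \<Longrightarrow> homog p g \<Longrightarrow> homog p (f + g)"
  unfolding homog_def lookup_add by (metis add.right_neutral)

lemma homog_uminus: "homog p f \<Longrightarrow> homog p (- f)"
  by (simp add: homog_def)

lemma homog_diff: "homog p f \<Longrightarrow> homog p g \<Longrightarrow> homog p (f - g)"
  using homog_add[of p f "- g"] by (simp add: homog_uminus)

lemma homog_sum: "(\<And>x. x \<in> S \<Longrightarrow> homog p (f x)) \<Longrightarrow> homog p (sum f S)"
  by (induction S rule: infinite_finite_induct) (auto intro: homog_add)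

lemma homog_cst_mon: "homog (odd_word w) (cst c * mon w)"
  by (auto simp: homog_def cst_mon lookup_single when_def split: if_splits)

lemma homog_mon: "p = odd_word w \<Longrightarrow> homog p (mon w)"
  using homog_cst_mon[of w 1] by simp

lemma homog_1: "homog False 1"
  using homog_mon[of False "[]"] by simp

lemma homog_koszul: "homog p f \<Longrightarrow> homog p (koszul a b * f)"
  by (simp add: koszul_def homog_uminus)

lemma homog_induct [consumes 1, case_names zero mon add]:
  assumes "homog p f" and "P 0" and "\<And>c w. odd_word w = p \<Longrightarrow> P (cst c * mon w)"
    and "\<And>f g. P f \<Longrightarrow> P g \<Longrightarrow> P (f + g)"
  shows "P f"
proof -
  have s: "P (Poly_Mapping.single w (Poly_Mapping.lookup f w))" for w
  proof (cases "Poly_Mapping.lookup f w = 0")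
    case False
    then show ?thesis
      using assms(1) assms(3)[of "letters w" "Poly_Mapping.lookup f w"] by (cases w) (auto simp: homog_def cst_mon)
  qed (simp add: assms(2))
  have "P (\<Sum>w\<in>S. Poly_Mapping.single w (Poly_Mapping.lookup f w))" if "finite S" for S
    using that by (induction S) (auto simp: s assms(2,4))
  from this[OF finite_keys[of f]] show ?thesis by (simp add: poly_mapping_sum_monomials)
qed

lemma homog_mult:
  assumes "homog p f" "homog q g" "r = (p \<noteq> q)"
  shows "homog r (f * g)"
  using assms(1)
proof (induction rule: homog_induct)
  case (mon c w)
  note w = mon
  show ?case using assms(2)
  proof (induction rule: homog_induct)
    case (mon d v)
    have "cst c * mon w * (cst d * mon v) = cst (c * d) * mon (w @ v)"
      unfolding cst_mon_mult cst_mult by (simp only: mult.assoc)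
    then show ?case using homog_cst_mon[of "w @ v" "c * d"] w mon assms(3)
      by (simp add: odd_word_append)
  qed (simp_all add: distrib_left homog_add)
qed (simp_all add: distrib_right homog_add)

lemma homog_lin_ext:
  assumes "homog p f" "\<And>w. odd_word w = p \<Longrightarrow> homog q (g w)"
  shows "homog q (lin_ext g f)"
  using assms(1)
proof (induction rule: homog_induct)
  case (mon c w)
  have "homog False (cst c)" using homog_cst_mon[of "[]" c] by simp
  from homog_mult[OF this assms(2)[OF mon]] show ?case by (simp add: lin_ext_cst_mon)
qed (simp_all add: lin_ext_add homog_add)

lemma homog_der_word:
  assumes "\<And>x. homog (\<not> is_odd x) (d x)" "p = (\<not> odd_word w)"
  shows "homog p (der_word d w)"
  using assms(2)
proof (induction w arbitrary: p)
  case (Cons x w)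
  show ?case
    by (auto intro!: homog_add homog_mult[OF assms(1) homog_mon[OF refl]] homog_koszul
        homog_mult[OF homog_mon[OF refl] Cons.IH[OF refl]]
        simp: Cons.prems odd_word_Cons mult.assoc)
qed simp

lemma grade_inv_homog: "homog p f \<Longrightarrow> grade_inv f = koszul p True * f"
proof (induction rule: homog_induct)
  case (mon c w)
  then show ?case
    by (simp add: grade_inv_def lin_ext_cst_mon koszul_def)
qed (simp_all add: grade_inv_def lin_ext_add distrib_left)

section \<open>Presented algebras\<close>

inductive_set ideal_gen :: "'a::ring_1 set \<Rightarrow> 'a set" for R where
  zero: "0 \<in> ideal_gen R"
| gen: "r \<in> R \<Longrightarrow> a * r * b \<in> ideal_gen R"
| add: "x \<in> ideal_gen R \<Longrightarrow> y \<in> ideal_gen R \<Longrightarrow> x + y \<in> ideal_gen R"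

lemma ideal_gen_rel: "r \<in> R \<Longrightarrow> r \<in> ideal_gen R"
  using ideal_gen.gen[of r R 1 1] by simp

lemma ideal_gen_mult: "x \<in> ideal_gen R \<Longrightarrow> a * x * b \<in> ideal_gen R"
proof (induction rule: ideal_gen.induct)
  case (gen r a' b')
  then show ?case using ideal_gen.gen[of r R "a * a'" "b' * b"] by (simp add: mult.assoc)
qed (auto simp: distrib_left distrib_right intro: ideal_gen.intros)

lemma ideal_gen_mult_left: "x \<in> ideal_gen R \<Longrightarrow> a * x \<in> ideal_gen R"
  and ideal_gen_mult_right: "x \<in> ideal_gen R \<Longrightarrow> x * a \<in> ideal_gen R"
  using ideal_gen_mult[of x R a 1] ideal_gen_mult[of x R 1 a] by simp_all

lemma ideal_gen_uminus: "x \<in> ideal_gen R \<Longrightarrow> - x \<in> ideal_gen R"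
  using ideal_gen_mult_left[of x R "- 1"] by simp

lemma ideal_gen_diff: "x \<in> ideal_gen R \<Longrightarrow> y \<in> ideal_gen R \<Longrightarrow> x - y \<in> ideal_gen R"
  using ideal_gen.add[of x R "- y"] by (simp add: ideal_gen_uminus)

lemma equivp_ideal_gen: "equivp (\<lambda>x y. x - y \<in> ideal_gen R)"
proof (intro equivpI reflpI sympI transpI)
  fix x y z
  show "x - x \<in> ideal_gen R" by (simp add: ideal_gen.zero)
  show "x - y \<in> ideal_gen R \<Longrightarrow> y - x \<in> ideal_gen R"
    using ideal_gen_uminus[of "x - y" R] by simp
  show "x - y \<in> ideal_gen R \<Longrightarrow> y - z \<in> ideal_gen R \<Longrightarrow> x - z \<in> ideal_gen R"
    using ideal_gen.add[of "x - y" R "y - z"] by simp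
qed

lemma ideal_gen_cong_add:
  "x - x' \<in> ideal_gen R \<Longrightarrow> y - y' \<in> ideal_gen R \<Longrightarrow> (x + y) - (x' + y') \<in> ideal_gen R"
  using ideal_gen.add[of "x - x'" R "y - y'"] by (simp add: algebra_simps)

lemma ideal_gen_cong_diff:
  "x - x' \<in> ideal_gen R \<Longrightarrow> y - y' \<in> ideal_gen R \<Longrightarrow> (x - y) - (x' - y') \<in> ideal_gen R"
  using ideal_gen_diff[of "x - x'" R "y - y'"] by (simp add: algebra_simps)

lemma ideal_gen_cong_uminus: "x - x' \<in> ideal_gen R \<Longrightarrow> (- x) - (- x') \<in> ideal_gen R"
  using ideal_gen_uminus[of "x - x'" R] by simp

lemma ideal_gen_cong_mult:
  assumes "x - x' \<in> ideal_gen R" "y - y' \<in> ideal_gen R"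
  shows "x * y - x' * y' \<in> ideal_gen R"
proof -
  have "x * y - x' * y' = (x - x') * y + x' * (y - y')" by (simp add: algebra_simps)
  then show ?thesis
    using assms by (auto intro: ideal_gen.add ideal_gen_mult_left ideal_gen_mult_right)
qed

lemma lookup_mult_0:
  "Poly_Mapping.lookup (f * g) 0 = Poly_Mapping.lookup f 0 * Poly_Mapping.lookup (g :: 'x free_alg) 0"
proof (induction f rule: free_alg_induct)
  case (mon c w)
  show ?case
  proof (induction g rule: free_alg_induct)
    case (mon d v)
    have z: "(0 :: 'x word) = u + v \<longleftrightarrow> u = 0 \<and> v = 0" for u v
      by (cases u; cases v) (auto simp: zero_word_def plus_word_def)
    have "Poly_Mapping.lookup (Poly_Mapping.single u c * Poly_Mapping.single u' d) 0 =
        Poly_Mapping.lookup (Poly_Mapping.single u c) 0 *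
        Poly_Mapping.lookup (Poly_Mapping.single (u' :: 'x word) d) 0" for u u'
      using z[of u u'] by (auto simp: mult_single lookup_single when_def)
    then show ?case by (simp only: cst_mon)
  qed (simp add: distrib_left lookup_add)
qed (simp add: distrib_right lookup_add)

lemma lookup_gen_0: "Poly_Mapping.lookup (gen x) 0 = 0"
  by (simp add: mon_def lookup_single zero_word_def)

lemma lookup_koszul_0:
  "Poly_Mapping.lookup f 0 = 0 \<Longrightarrow> Poly_Mapping.lookup (koszul p q * f :: 'x free_alg) 0 = 0"
  by (simp add: lookup_mult_0)

lemma one_notin_ideal_gen:
  assumes "\<And>r. r \<in> R \<Longrightarrow> Poly_Mapping.lookup r 0 = 0"
  shows "(0 :: 'x free_alg) - 1 \<notin> ideal_gen R"
proof
  have "Poly_Mapping.lookup r 0 = 0" if "r \<in> ideal_gen R" for r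
    using that by (induction rule: ideal_gen.induct) (simp_all add: lookup_mult_0 assms lookup_add)
  moreover assume "(0 :: 'x free_alg) - 1 \<in> ideal_gen R"
  ultimately have "Poly_Mapping.lookup (0 - 1 :: 'x free_alg) 0 = 0" .
  then show False by (simp add: lookup_minus)
qed

subsection \<open>Free graded-commutative algebras\<close>

text \<open>Over the complex numbers these relations include that odd generators square to zero.\<close>

definition supercomm_rels :: "'x::graded free_alg set" where
  "supercomm_rels =
     {gen x * gen y - koszul (is_odd x) (is_odd y) * (gen y * gen x) | x y. True}"

lemma lookup_supercomm_rels: "r \<in> supercomm_rels \<Longrightarrow> Poly_Mapping.lookup r 0 = 0"
  by (auto simp: supercomm_rels_def lookup_minus lookup_mult_0 lookup_gen_0)

quotient_type (overloaded) 'x gca = "'x::graded free_alg" / "\<lambda>f g. f - g \<in> ideal_gen supercomm_rels"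
  by (rule equivp_ideal_gen)

instantiation gca :: (graded) ring_1
begin
lift_definition zero_gca :: "'a gca" is 0 .
lift_definition one_gca :: "'a gca" is 1 .
lift_definition plus_gca :: "'a gca \<Rightarrow> 'a gca \<Rightarrow> 'a gca" is "(+)" by (rule ideal_gen_cong_add)
lift_definition minus_gca :: "'a gca \<Rightarrow> 'a gca \<Rightarrow> 'a gca" is "(-)" by (rule ideal_gen_cong_diff)
lift_definition uminus_gca :: "'a gca \<Rightarrow> 'a gca" is uminus by (rule ideal_gen_cong_uminus)
lift_definition times_gca :: "'a gca \<Rightarrow> 'a gca \<Rightarrow> 'a gca" is "(*)" by (rule ideal_gen_cong_mult)
instance
proof
  have "(0 :: 'a free_alg) - 1 \<notin> ideal_gen supercomm_rels"
    by (rule one_notin_ideal_gen) (rule lookup_supercomm_rels)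
  then show "(0 :: 'a gca) \<noteq> 1" by transfer
qed (transfer; simp add: algebra_simps ideal_gen.zero)+
end


locale free_alg_quotient =
  fixes proj :: "'x::graded free_alg \<Rightarrow> 'a::ring_1" and R :: "'x free_alg set"
  assumes proj_add: "proj (f + g) = proj f + proj g"
    and proj_mult: "proj (f * g) = proj f * proj g"
    and proj_1: "proj 1 = 1"
    and proj_eq_0_iff: "proj f = 0 \<longleftrightarrow> f \<in> ideal_gen R"
    and supercomm: "supercomm_rels \<subseteq> R"
begin

lemma proj_0 [simp]: "proj 0 = 0"
  by (simp add: proj_eq_0_iff ideal_gen.zero)

lemma proj_uminus: "proj (- f) = - proj f"
  using proj_add[of f "- f"] by (simp add: minus_unique)

lemma proj_diff: "proj (f - g) = proj f - proj g"
  using proj_add[of f "- g"] by (simp add: proj_uminus)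

lemma proj_sum: "proj (sum f S) = (\<Sum>x\<in>S. proj (f x))"
  by (induction S rule: infinite_finite_induct) (simp_all add: proj_add)

lemma proj_koszul: "proj (koszul p q * f) = koszul p q * proj f"
  by (simp add: koszul_def proj_uminus)

lemma proj_koszul_1: "proj (koszul p q) = koszul p q"
  using proj_koszul[of p q 1] by (simp add: proj_1)

lemma proj_rel: "r \<in> R \<Longrightarrow> proj r = 0"
  by (simp add: proj_eq_0_iff ideal_gen_rel)

lemma proj_gen_comm:
  "proj (gen x) * proj (gen y) = koszul (is_odd x) (is_odd y) * (proj (gen y) * proj (gen x))"
proof -
  have "gen x * gen y - koszul (is_odd x) (is_odd y) * (gen y * gen x) \<in> R"
    using supercomm by (auto simp: supercomm_rels_def)
  from proj_rel[OF this] show ?thesis by (simp add: proj_diff proj_koszul flip: proj_mult)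
qed

lemma proj_gen_mon_comm:
  "proj (gen x) * proj (mon w) = koszul (is_odd x) (odd_word w) * (proj (mon w) * proj (gen x))"
proof (induction w)
  case (Cons y w)
  have 1: "proj (mon (y # w)) = proj (gen y) * proj (mon w)"
    by (simp add: mon_mult flip: proj_mult)
  have "proj (gen x) * proj (mon (y # w)) = (proj (gen x) * proj (gen y)) * proj (mon w)"
    by (simp only: 1 mult.assoc)
  also have "\<dots> = koszul (is_odd x) (is_odd y) * (proj (gen y) * (proj (gen x) * proj (mon w)))"
    unfolding proj_gen_comm[of x y] by (simp only: mult.assoc)
  also have "\<dots> = koszul (is_odd x) (odd_word (y # w)) * (proj (mon (y # w)) * proj (gen x))"
    unfolding Cons.IH 1 by (simp add: koszul_def odd_word_Cons mult.assoc)
  finally show ?case .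
qed (simp add: koszul_def proj_1)

lemma proj_mon_comm:
  "proj (mon u) * proj (mon w) = koszul (odd_word u) (odd_word w) * (proj (mon w) * proj (mon u))"
proof (induction u)
  case (Cons x u)
  have 1: "proj (mon (x # u)) = proj (gen x) * proj (mon u)"
    by (simp add: mon_mult flip: proj_mult)
  have "proj (mon (x # u)) * proj (mon w) = proj (gen x) * (proj (mon u) * proj (mon w))"
    by (simp only: 1 mult.assoc)
  also have "\<dots> = koszul (odd_word u) (odd_word w) * ((proj (gen x) * proj (mon w)) * proj (mon u))"
    unfolding Cons.IH by (simp add: koszul_def mult.assoc)
  also have "\<dots> = koszul (odd_word (x # u)) (odd_word w) * (proj (mon w) * proj (mon (x # u)))"
    unfolding proj_gen_mon_comm[of x w] 1 by (simp add: koszul_def odd_word_Cons mult.assoc)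
  finally show ?case .
qed (simp add: koszul_def proj_1)

lemma proj_cst_comm: "proj (cst c) * proj f = proj f * proj (cst c)"
  by (metis cst_comm proj_mult)

lemma proj_homog_comm:
  assumes "homog p f" "homog q g"
  shows "proj f * proj g = koszul p q * (proj g * proj f)"
  using assms(1)
proof (induction rule: homog_induct)
  case (mon c w)
  note w = mon
  show ?case using assms(2)
  proof (induction rule: homog_induct)
    case (mon d v)
    have "proj (cst c * mon w) * proj (cst d * mon v) = proj (cst (c * d)) * (proj (mon w) * proj (mon v))"
      unfolding proj_mult[symmetric] cst_mon_mult cst_mult mon_mult by (simp only: mult.assoc)
    moreover have "proj (cst d * mon v) * proj (cst c * mon w) =
        proj (cst (c * d)) * (proj (mon v) * proj (mon w))"
      unfolding proj_mult[symmetric] cst_mon_mult mult.commute[of c d] cst_mult mon_mult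
      by (simp only: mult.assoc)
    ultimately show ?case
      using proj_mon_comm[of w v] w mon by (simp add: koszul_def)
  qed (simp_all add: proj_add distrib_left distrib_right)
qed (simp_all add: proj_add distrib_left distrib_right)

lemma proj_odd_der_eq_0:
  assumes R: "\<And>r. r \<in> R \<Longrightarrow> proj (odd_der d r) = 0"
    and homog: "\<And>r. r \<in> R \<Longrightarrow> \<exists>p. homog p r"
    and "f \<in> ideal_gen R"
  shows "proj (odd_der d f) = 0"
  using assms(3)
proof (induction rule: ideal_gen.induct)
  case (gen r a b)
  obtain p where "homog p r" using homog[OF gen] by blast
  then have "proj (grade_inv r) = 0"
    by (simp add: grade_inv_homog proj_koszul proj_rel[OF gen])
  then show ?case
    by (simp add: mult.assoc odd_der_mult proj_add proj_mult R[OF gen] proj_rel[OF gen])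
qed (simp_all add: odd_der_def lin_ext_add proj_add)

lemma odd_der_gen_mult:
  "odd_der d (gen x * f) = d x * f + koszul (is_odd x) True * (gen x * odd_der d f)"
  by (simp add: odd_der_mult grade_inv_homog[OF homog_mon[OF refl]] mult.assoc)
     (simp add: odd_der_def)

lemma odd_der_gen: "odd_der d (gen x) = d x"
  by (simp add: odd_der_def)

lemma proj_odd_der_supercomm:
  assumes d: "\<And>x. homog (\<not> is_odd x) (d x)" and "r \<in> supercomm_rels"
  shows "proj (odd_der d r) = 0"
proof -
  obtain x y where r: "r = gen x * gen y - koszul (is_odd x) (is_odd y) * (gen y * gen x)"
    using assms(2) by (auto simp: supercomm_rels_def)
  have 1: "proj (d x) * proj (gen y) = koszul (\<not> is_odd x) (is_odd y) * (proj (gen y) * proj (d x))"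
    by (intro proj_homog_comm d homog_mon) simp
  have 2: "proj (gen x) * proj (d y) = koszul (is_odd x) (\<not> is_odd y) * (proj (d y) * proj (gen x))"
    by (intro proj_homog_comm d homog_mon) simp
  have "odd_der d r = d x * gen y + koszul (is_odd x) True * (gen x * d y)
      - koszul (is_odd x) (is_odd y) * (d y * gen x + koszul (is_odd y) True * (gen y * d x))"
    unfolding r odd_der_gen_mult[symmetric, of d _ "gen _", unfolded odd_der_gen]
    by (simp add: odd_der_def lin_ext_diff lin_ext_koszul)
  then show ?thesis
    by (simp add: proj_diff proj_add proj_koszul_1 proj_mult 1 2) (simp add: koszul_def)
qed

end

lemma homog_supercomm_rels: "r \<in> supercomm_rels \<Longrightarrow> \<exists>p. homog p r"
proof -
  assume "r \<in> supercomm_rels"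
  then obtain x y where "r = gen x * gen y - koszul (is_odd x) (is_odd y) * (gen y * gen x)"
    by (auto simp: supercomm_rels_def)
  then have "homog (is_odd x \<noteq> is_odd y) r"
    by (auto intro!: homog_diff homog_koszul homog_mult[OF homog_mon homog_mon])
  then show ?thesis by blast
qed

lemma proj_gca: "free_alg_quotient abs_gca (supercomm_rels :: 'x::graded free_alg set)"
  by unfold_locales
     (simp_all add: plus_gca.abs_eq times_gca.abs_eq one_gca.abs_eq zero_gca.abs_eq gca.abs_eq_iff)

text \<open>The odd derivation of a free graded-commutative algebra with prescribed values on generators.\<close>

lemma gca_der_well_defined:
  assumes "\<And>x. homog (\<not> is_odd x) (d x)" "f - g \<in> ideal_gen supercomm_rels"
  shows "odd_der d f - odd_der d g \<in> ideal_gen supercomm_rels"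
proof -
  interpret free_alg_quotient abs_gca "supercomm_rels :: 'a free_alg set" by (rule proj_gca)
  have "abs_gca (odd_der d (f - g)) = 0"
    by (rule proj_odd_der_eq_0[OF _ homog_supercomm_rels assms(2)])
       (rule proj_odd_der_supercomm[OF assms(1)])
  then show ?thesis by (simp add: proj_eq_0_iff odd_der_def lin_ext_diff)
qed

section \<open>Letters, words and supercharge\<close>

datatype flavour = F1 | F2

lemma UNIV_flavour: "UNIV = {F1, F2}"
  using flavour.exhaust by auto

instance flavour :: finite
  by standard (simp add: UNIV_flavour)

definition eps :: "flavour \<Rightarrow> flavour \<Rightarrow> 'a::ring_1" where
  "eps a b = (if a = b then 0 else if a = F1 then 1 else - 1)"

datatype letter =
    phi flavour | Dphi flavour | psi flavour
  | phib flavour | Dphib flavour | psib flavour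

fun barred :: "letter \<Rightarrow> bool" where
  "barred (phi a) = False" | "barred (Dphi a) = False" | "barred (psi a) = False"
| "barred (phib a) = True" | "barred (Dphib a) = True" | "barred (psib a) = True"

instantiation letter :: graded
begin
fun is_odd_letter :: "letter \<Rightarrow> bool" where
  "is_odd_letter (psi a) = True" | "is_odd_letter (psib a) = True"
| "is_odd_letter (phi a) = False" | "is_odd_letter (Dphi a) = False"
| "is_odd_letter (phib a) = False" | "is_odd_letter (Dphib a) = False"
instance ..
end

definition Lam :: "letter free_alg" where
  "Lam = (\<Sum>a\<in>UNIV. \<Sum>b\<in>UNIV. eps a b * gen (psib a) * gen (phi b))
       - (\<Sum>a\<in>UNIV. \<Sum>b\<in>UNIV. eps a b * gen (phib a) * gen (psi b))"

definition Lam_tilde :: "letter free_alg" where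
  "Lam_tilde = (\<Sum>a\<in>UNIV. \<Sum>b\<in>UNIV. eps a b * gen (psi a) * gen (phib b))
             - (\<Sum>a\<in>UNIV. \<Sum>b\<in>UNIV. eps a b * gen (phi a) * gen (psib b))"

fun Q_letter :: "letter \<Rightarrow> letter free_alg" where
  "Q_letter (phi a) = 0"
| "Q_letter (phib a) = 0"
| "Q_letter (psi a) =
     (\<Sum>b\<in>UNIV. \<Sum>c\<in>UNIV. eps b c * gen (phi b) * gen (phib a) * gen (phi c))"
| "Q_letter (psib a) =
     (\<Sum>b\<in>UNIV. \<Sum>c\<in>UNIV. eps b c * gen (phib b) * gen (phi a) * gen (phib c))"
| "Q_letter (Dphi e) = gen (phi e) * Lam - Lam_tilde * gen (phi e)"
| "Q_letter (Dphib e) = gen (phib e) * Lam_tilde - Lam * gen (phib e)"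

definition Q_word :: "letter list \<Rightarrow> letter free_alg" where
  "Q_word = der_word Q_letter"

lemma homog_eps: "homog p f \<Longrightarrow> homog p (eps a b * f)"
  by (simp add: eps_def homog_uminus)

lemma homog_Q_letter: "homog (\<not> is_odd x) (Q_letter x)"
proof -
  have L: "homog True Lam" "homog True Lam_tilde"
    unfolding Lam_def Lam_tilde_def mult.assoc mon_mult
    by (intro homog_diff homog_sum homog_eps homog_mon; simp add: odd_word_Cons)+
  have "homog False (gen (phi a))" "homog False (gen (phib a))" for a
    by (simp_all add: homog_mon)
  note h = this L
  show ?thesis
  proof (cases x)
    case (Dphi a)
    then show ?thesis
      by (auto intro!: homog_diff homog_mult[OF h(1,3)] homog_mult[OF h(4,1)])
  next
    case (Dphib a)
    then show ?thesis
      by (auto intro!: homog_diff homog_mult[OF h(2,4)] homog_mult[OF h(3,2)])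
  qed (auto simp: mult.assoc mon_mult odd_word_Cons intro!: homog_sum homog_eps homog_mon)
qed

section \<open>Formal multi-trace operators\<close>

text \<open>
  Comparing the last letter with the first one as well makes the condition invariant under
  rotation and forces the length to be even and positive.
\<close>

definition alternating :: "letter list \<Rightarrow> bool" where
  "alternating w \<longleftrightarrow> w \<noteq> [] \<and> successively (\<lambda>x y. barred x \<noteq> barred y) (w @ [hd w])"

typedef trace_word = "{w. alternating w}"
  morphisms letters_of Trace_word
  by (rule exI[of _ "[phi F1, phib F1]"]) (simp add: alternating_def)

instantiation trace_word :: graded
begin
definition is_odd_trace_word :: "trace_word \<Rightarrow> bool" where
  "is_odd_trace_word t = odd_word (letters_of t)"
instance ..
end

text \<open>The trace of a word that does not alternate is a junk value, never used for words in the algebra.\<close>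

definition word_trace :: "letter list \<Rightarrow> trace_word free_alg" where
  "word_trace w = (if alternating w then gen (Trace_word w) else 0)"

abbreviation lin_trace :: "letter free_alg \<Rightarrow> trace_word free_alg" where
  "lin_trace \<equiv> lin_ext word_trace"

definition supercyclic_rels :: "trace_word free_alg set" where
  "supercyclic_rels =
     {word_trace (x # w) - koszul (is_odd x) (odd_word w) * word_trace (w @ [x]) | x w.
        alternating (x # w)}"

quotient_type formal_op =
  "trace_word free_alg" / "\<lambda>f g. f - g \<in> ideal_gen (supercomm_rels \<union> supercyclic_rels)"
  by (rule equivp_ideal_gen)

lemma lookup_formal_rels:
  assumes "r \<in> supercomm_rels \<union> supercyclic_rels" shows "Poly_Mapping.lookup r 0 = 0"
proof -
  have "Poly_Mapping.lookup (word_trace w) 0 = 0" for w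
    by (simp add: word_trace_def lookup_gen_0)
  then show ?thesis using assms lookup_supercomm_rels
    by (auto simp: supercyclic_rels_def lookup_minus lookup_koszul_0)
qed

instantiation formal_op :: ring_1
begin
lift_definition zero_formal_op :: formal_op is 0 .
lift_definition one_formal_op :: formal_op is 1 .
lift_definition plus_formal_op :: "formal_op \<Rightarrow> formal_op \<Rightarrow> formal_op" is "(+)"
  by (rule ideal_gen_cong_add)
lift_definition minus_formal_op :: "formal_op \<Rightarrow> formal_op \<Rightarrow> formal_op" is "(-)"
  by (rule ideal_gen_cong_diff)
lift_definition uminus_formal_op :: "formal_op \<Rightarrow> formal_op" is uminus
  by (rule ideal_gen_cong_uminus)
lift_definition times_formal_op :: "formal_op \<Rightarrow> formal_op \<Rightarrow> formal_op" is "(*)"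
  by (rule ideal_gen_cong_mult)
instance
proof
  have "(0 :: trace_word free_alg) - 1 \<notin> ideal_gen (supercomm_rels \<union> supercyclic_rels)"
    by (rule one_notin_ideal_gen) (rule lookup_formal_rels)
  then show "(0 :: formal_op) \<noteq> 1" by transfer
qed (transfer; simp add: algebra_simps ideal_gen.zero)+
end

lemma proj_formal_op: "free_alg_quotient abs_formal_op (supercomm_rels \<union> supercyclic_rels)"
  by unfold_locales
     (simp_all add: plus_formal_op.abs_eq times_formal_op.abs_eq one_formal_op.abs_eq
        zero_formal_op.abs_eq formal_op.abs_eq_iff)

lift_definition Tr :: "letter list \<Rightarrow> formal_op" is word_trace .

lemma successively_snoc2:
  "successively P (w @ [x, y]) \<longleftrightarrow> successively P (w @ [x]) \<and> P x y"
  by (auto simp: successively_append_iff)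

lemma alternating_rotate1: "alternating (x # w) \<longleftrightarrow> alternating (w @ [x])"
proof (cases w)
  case (Cons y v)
  have "successively P (x # y # v @ [x]) \<longleftrightarrow> successively P (y # v @ [x, y])"
    if "\<And>x y. P x y \<longleftrightarrow> P y x" for P :: "letter \<Rightarrow> letter \<Rightarrow> bool"
    using successively_snoc2[of P "y # v" x y] that by auto
  from this[of "\<lambda>x y. barred x \<noteq> barred y"] show ?thesis
    using Cons by (auto simp: alternating_def)
qed simp

lemma alternating_rotate: "alternating (u @ v) \<longleftrightarrow> alternating (v @ u)"
proof (induction u arbitrary: v)
  case (Cons x u)
  from Cons[of "v @ [x]"] show ?case using alternating_rotate1[of x "u @ v"] by simp
qed simp

lemma homog_word_trace: "p = odd_word w \<Longrightarrow> homog p (word_trace w)"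
  by (auto simp: word_trace_def is_odd_trace_word_def Trace_word_inverse intro!: homog_mon)

lemma homog_formal_rels: "r \<in> supercomm_rels \<union> supercyclic_rels \<Longrightarrow> \<exists>p. homog p r"
proof -
  have "\<exists>p. homog p r" if rel: "r \<in> supercyclic_rels" for r
  proof -
    obtain x w where
      r: "r = word_trace (x # w) - koszul (is_odd x) (odd_word w) * word_trace (w @ [x])"
      using rel by (auto simp: supercyclic_rels_def)
    have "homog (odd_word (x # w)) r" unfolding r
      by (intro homog_diff homog_koszul homog_word_trace) (auto simp: odd_word_append odd_word_Cons)
    then show ?thesis by blast
  qed
  then show "r \<in> supercomm_rels \<union> supercyclic_rels \<Longrightarrow> \<exists>p. homog p r"
    using homog_supercomm_rels by blast
qed

interpretation formal: free_alg_quotient abs_formal_op "supercomm_rels \<union> supercyclic_rels"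
  by (rule proj_formal_op)

lemma formal_trace_rotate1:
  "abs_formal_op (word_trace (x # w)) =
     koszul (is_odd x) (odd_word w) * abs_formal_op (word_trace (w @ [x]))"
proof (cases "alternating (x # w)")
  case True
  then have "word_trace (x # w) - koszul (is_odd x) (odd_word w) * word_trace (w @ [x])
      \<in> supercomm_rels \<union> supercyclic_rels"
    by (auto simp: supercyclic_rels_def)
  from formal.proj_rel[OF this] show ?thesis
    by (simp only: formal.proj_diff formal.proj_koszul) simp
next
  case False
  then show ?thesis using alternating_rotate1[of x w] by (simp add: word_trace_def)
qed

lemma formal_trace_append:
  "abs_formal_op (word_trace (u @ v)) =
     koszul (odd_word u) (odd_word v) * abs_formal_op (word_trace (v @ u))"
proof (induction u arbitrary: v)
  case (Cons x u)
  show ?case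
    using formal_trace_rotate1[of x "u @ v"] Cons[of "v @ [x]"]
    by (auto simp: koszul_def odd_word_append odd_word_Cons)
qed (simp add: koszul_def)

lemma formal_trace_comm:
  assumes "homog p f" "homog q g"
  shows "abs_formal_op (lin_trace (f * g)) = koszul p q * abs_formal_op (lin_trace (g * f))"
  using assms(1)
proof (induction rule: homog_induct)
  case (mon c w)
  note w = mon
  show ?case using assms(2)
  proof (induction rule: homog_induct)
    case (mon d v)
    have "abs_formal_op (cst c) * (abs_formal_op (cst d) * z) =
        abs_formal_op (cst d) * (abs_formal_op (cst c) * z)" for z
      by (simp only: mult.assoc[symmetric] formal.proj_cst_comm[of c "cst d"])
    then show ?case using formal_trace_append[of w v] w mon
      unfolding cst_mon_mult lin_ext_scale lin_ext_mon formal.proj_mult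
      by (simp add: koszul_def)
  qed (simp_all add: distrib_left distrib_right lin_ext_add formal.proj_add)
qed (simp_all add: distrib_left distrib_right lin_ext_add formal.proj_add)

definition Q_trace_word :: "trace_word \<Rightarrow> trace_word free_alg" where
  "Q_trace_word t = lin_trace (Q_word (letters_of t))"

lemma homog_Q_word: "p = (\<not> odd_word w) \<Longrightarrow> homog p (Q_word w)"
  unfolding Q_word_def by (rule homog_der_word[OF homog_Q_letter])

lemma homog_Q_trace_word: "homog (\<not> is_odd t) (Q_trace_word t)"
  unfolding Q_trace_word_def is_odd_trace_word_def
  by (rule homog_lin_ext[OF homog_Q_word[OF refl]]) (simp add: homog_word_trace)

lemma odd_der_Q_word_trace:
  "alternating w \<Longrightarrow> odd_der Q_trace_word (word_trace w) = lin_trace (Q_word w)"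
  by (simp add: word_trace_def odd_der_def koszul_def Q_trace_word_def Trace_word_inverse)

lemma formal_Q_supercyclic:
  assumes "r \<in> supercyclic_rels"
  shows "abs_formal_op (odd_der Q_trace_word r) = 0"
proof -
  obtain x w where
    r: "r = word_trace (x # w) - koszul (is_odd x) (odd_word w) * word_trace (w @ [x])"
    and alt: "alternating (x # w)"
    using assms by (auto simp: supercyclic_rels_def)
  have "odd_der Q_trace_word r = lin_trace (Q_word (x # w))
      - koszul (is_odd x) (odd_word w) * lin_trace (Q_word (w @ [x]))"
    using alt alternating_rotate1[of x w] unfolding r
    by (simp add: odd_der_Q_word_trace[symmetric] odd_der_def lin_ext_diff lin_ext_koszul)
  moreover have "Q_word (x # w) = Q_letter x * mon w + koszul (is_odd x) True * (gen x * Q_word w)"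
    by (simp add: Q_word_def mult.assoc)
  moreover have
    "Q_word (w @ [x]) = Q_word w * gen x + koszul (odd_word w) True * (mon w * Q_letter x)"
    by (simp add: Q_word_def der_word_append mult.assoc)
  moreover have "abs_formal_op (lin_trace (Q_letter x * mon w)) =
      koszul (\<not> is_odd x) (odd_word w) * abs_formal_op (lin_trace (mon w * Q_letter x))"
    by (intro formal_trace_comm homog_Q_letter homog_mon refl)
  moreover have "abs_formal_op (lin_trace (gen x * Q_word w)) =
      koszul (is_odd x) (\<not> odd_word w) * abs_formal_op (lin_trace (Q_word w * gen x))"
    by (intro formal_trace_comm homog_Q_word homog_mon refl) simp
  ultimately show ?thesis
    by (simp add: lin_ext_add lin_ext_koszul distrib_left formal.proj_diff formal.proj_add
        formal.proj_koszul formal.proj_mult formal.proj_koszul_1)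
       (simp add: koszul_def)
qed

lift_definition Q_formal :: "formal_op \<Rightarrow> formal_op" is "odd_der Q_trace_word"
proof -
  fix f g :: "trace_word free_alg"
  assume "f - g \<in> ideal_gen (supercomm_rels \<union> supercyclic_rels)"
  then have "abs_formal_op (odd_der Q_trace_word (f - g)) = 0"
    using formal.proj_odd_der_eq_0[of Q_trace_word "f - g", OF _ homog_formal_rels]
      formal.proj_odd_der_supercomm[of Q_trace_word, OF homog_Q_trace_word] formal_Q_supercyclic
    by blast
  then show "odd_der Q_trace_word f - odd_der Q_trace_word g
      \<in> ideal_gen (supercomm_rels \<union> supercyclic_rels)"
    by (simp add: formal.proj_eq_0_iff odd_der_def lin_ext_diff)
qed

section \<open>Generic matrices\<close>

datatype 'n entry = Entry letter 'n 'n

instantiation entry :: (type) graded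
begin
fun is_odd_entry :: "'a entry \<Rightarrow> bool" where "is_odd_entry (Entry x i j) = is_odd x"
instance ..
end

definition generic_matrix :: "letter \<Rightarrow> 'n::finite entry free_alg ^ 'n ^ 'n" where
  "generic_matrix x = (\<chi> i j. gen (Entry x i j))"

fun word_matrix :: "letter list \<Rightarrow> 'n::finite entry free_alg ^ 'n ^ 'n" where
  "word_matrix [] = mat 1"
| "word_matrix (x # w) = generic_matrix x ** word_matrix w"

definition eval_entry :: "'n::finite \<Rightarrow> 'n \<Rightarrow> letter free_alg \<Rightarrow> 'n entry free_alg" where
  "eval_entry i j = lin_ext (\<lambda>w. word_matrix w $ i $ j)"

definition eval_trace_word :: "trace_word \<Rightarrow> 'n::finite entry free_alg" where
  "eval_trace_word t = trace (word_matrix (letters_of t))"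

fun Q_entry :: "'n::finite entry \<Rightarrow> 'n entry free_alg" where
  "Q_entry (Entry x i j) = eval_entry i j (Q_letter x)"

lemma word_matrix_append: "word_matrix (u @ v) = word_matrix u ** word_matrix v"
  by (induction u) (simp_all add: matrix_mul_assoc)

lemma homog_word_matrix: "p = odd_word w \<Longrightarrow> homog p (word_matrix w $ i $ j)"
proof (induction w arbitrary: p i)
  case Nil
  then show ?case by (simp add: mat_def homog_1)
next
  case (Cons x w)
  have "homog (is_odd x) (gen (Entry x i k))" for k by (simp add: homog_mon)
  then show ?case
    by (auto simp: matrix_matrix_mult_def generic_matrix_def Cons.prems odd_word_Cons
        intro!: homog_sum homog_mult[OF _ Cons.IH[OF refl]])
qed

lemma homog_eval_trace_word: "homog (is_odd t) (eval_trace_word t)"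
  by (simp add: eval_trace_word_def trace_def is_odd_trace_word_def homog_sum homog_word_matrix)

lemma homog_Q_entry: "homog (\<not> is_odd e) (Q_entry e)"
proof (cases e)
  case (Entry x i j)
  then show ?thesis
    unfolding Entry Q_entry.simps eval_entry_def is_odd_entry.simps
    by (intro homog_lin_ext[OF homog_Q_letter] homog_word_matrix) simp
qed

lift_definition Q_matrix :: "'n::finite entry gca \<Rightarrow> 'n entry gca" is "odd_der Q_entry"
  by (rule gca_der_well_defined[OF homog_Q_entry])

interpretation gca: free_alg_quotient abs_gca "supercomm_rels :: 'x::graded free_alg set"
  by (rule proj_gca)

lemma eval_supercyclic:
  assumes "r \<in> supercyclic_rels"
  shows "abs_gca (alg_hom eval_trace_word r :: 'n::finite entry free_alg) = 0"
proof -
  obtain x w where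
    r: "r = word_trace (x # w) - koszul (is_odd x) (odd_word w) * word_trace (w @ [x])"
    and alt: "alternating (x # w)"
    using assms by (auto simp: supercyclic_rels_def)
  have ev: "alg_hom eval_trace_word (word_trace w) = trace (word_matrix w :: 'n entry free_alg ^ 'n ^ 'n)"
    if "alternating w" for w
    using that by (simp add: word_trace_def alg_hom_def eval_trace_word_def Trace_word_inverse)
  have "alg_hom eval_trace_word r = trace (word_matrix (x # w) :: 'n entry free_alg ^ 'n ^ 'n)
      - koszul (is_odd x) (odd_word w) * trace (word_matrix (w @ [x]))"
    unfolding ev[OF alt, symmetric] ev[OF alt[unfolded alternating_rotate1[of x w]], symmetric] r
    by (simp add: alg_hom_def lin_ext_diff lin_ext_koszul)
  moreover have "trace (word_matrix (x # w) :: 'n entry free_alg ^ 'n ^ 'n) =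
      (\<Sum>i\<in>UNIV. \<Sum>j\<in>UNIV. gen (Entry x i j) * word_matrix w $ j $ i)"
    by (simp add: trace_def matrix_matrix_mult_def generic_matrix_def)
  moreover have "trace (word_matrix (w @ [x]) :: 'n entry free_alg ^ 'n ^ 'n) =
      (\<Sum>i\<in>UNIV. \<Sum>j\<in>UNIV. word_matrix w $ j $ i * gen (Entry x i j))"
  proof -
    have "word_matrix (w @ [x]) = word_matrix w ** (generic_matrix x :: 'n entry free_alg ^ 'n ^ 'n)"
      by (simp add: word_matrix_append)
    then show ?thesis
      by (subst sum.swap) (simp add: trace_def matrix_matrix_mult_def generic_matrix_def)
  qed
  moreover have "abs_gca (gen (Entry x i j)) * abs_gca (word_matrix w $ j $ i) =
      koszul (is_odd x) (odd_word w) *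
      (abs_gca (word_matrix w $ j $ i) * abs_gca (gen (Entry x i j)))" for i j :: 'n
    by (intro gca.proj_homog_comm homog_word_matrix homog_mon) simp_all
  ultimately show ?thesis
    by (simp add: gca.proj_diff gca.proj_sum gca.proj_mult gca.proj_koszul_1 sum_distrib_left)
qed

lemma eval_supercomm:
  assumes "r \<in> supercomm_rels"
  shows "abs_gca (alg_hom eval_trace_word r :: 'n::finite entry free_alg) = 0"
proof -
  obtain x y where r: "r = gen x * gen y - koszul (is_odd x) (is_odd y) * (gen y * gen x)"
    using assms by (auto simp: supercomm_rels_def)
  have "alg_hom eval_trace_word r = eval_trace_word x * (eval_trace_word y :: 'n entry free_alg)
      - koszul (is_odd x) (is_odd y) * (eval_trace_word y * eval_trace_word x)"
    unfolding r by (simp add: alg_hom_def lin_ext_diff lin_ext_koszul mon_mult)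
  then show ?thesis
    using gca.proj_homog_comm[OF homog_eval_trace_word[of x] homog_eval_trace_word[of y]]
    by (simp add: gca.proj_diff gca.proj_mult gca.proj_koszul_1)
qed

text \<open>The evaluation homomorphism, with \<open>N\<close> the cardinality of the index type.\<close>

lift_definition ev :: "formal_op \<Rightarrow> 'n::finite entry gca" is "alg_hom eval_trace_word"
proof -
  fix f g :: "trace_word free_alg"
  have "abs_gca (alg_hom eval_trace_word h :: 'n entry free_alg) = 0"
    if "h \<in> ideal_gen (supercomm_rels \<union> supercyclic_rels)" for h
    using that
  proof (induction rule: ideal_gen.induct)
    case (gen r a b)
    then have "abs_gca (alg_hom eval_trace_word r :: 'n entry free_alg) = 0"
      using eval_supercomm eval_supercyclic by blast
    then show ?case by (simp add: alg_hom_mult gca.proj_mult)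
  qed (simp_all add: alg_hom_def lin_ext_add gca.proj_add)
  moreover assume "f - g \<in> ideal_gen (supercomm_rels \<union> supercyclic_rels)"
  ultimately have "abs_gca (alg_hom eval_trace_word (f - g) :: 'n entry free_alg) = 0"
    by blast
  then show "alg_hom eval_trace_word f - (alg_hom eval_trace_word g :: 'n entry free_alg)
      \<in> ideal_gen supercomm_rels"
    by (simp add: gca.proj_eq_0_iff alg_hom_def lin_ext_diff)
qed

subsection \<open>Compatibility of the supercharge with evaluation\<close>

definition alt_supported :: "letter free_alg \<Rightarrow> bool" where
  "alt_supported f \<longleftrightarrow> (\<forall>w. Poly_Mapping.lookup f (Word w) \<noteq> 0 \<longrightarrow> alternating w)"

lemma alt_supported_0 [simp]: "alt_supported 0"
  by (simp add: alt_supported_def)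

lemma alt_supported_add: "alt_supported f \<Longrightarrow> alt_supported g \<Longrightarrow> alt_supported (f + g)"
  unfolding alt_supported_def lookup_add by (metis add.right_neutral)

lemma alt_supported_uminus: "alt_supported f \<Longrightarrow> alt_supported (- f)"
  by (simp add: alt_supported_def)

lemma alt_supported_diff: "alt_supported f \<Longrightarrow> alt_supported g \<Longrightarrow> alt_supported (f - g)"
  using alt_supported_add[of f "- g"] by (simp add: alt_supported_uminus)

lemma alt_supported_sum:
  "(\<And>x. x \<in> S \<Longrightarrow> alt_supported (f x)) \<Longrightarrow> alt_supported (sum f S)"
  by (induction S rule: infinite_finite_induct) (auto intro: alt_supported_add)

lemma alt_supported_mon: "alternating w \<Longrightarrow> alt_supported (mon w)"
  by (auto simp: alt_supported_def mon_def lookup_single when_def split: if_splits)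

lemma alt_supported_eps: "alt_supported f \<Longrightarrow> alt_supported (eps a b * f)"
  by (simp add: eps_def alt_supported_uminus)

lemma alternating_expand:
  assumes "alternating (u @ x # v)" "barred y1 = barred x" "barred y2 \<noteq> barred x" "barred y3 = barred x"
  shows "alternating (u @ [y1, y2, y3] @ v)"
proof -
  have "alternating (x # (v @ u))"
    using assms(1) alternating_rotate[of u "x # v"] by simp
  moreover have "alternating ([y1, y2, y3] @ s)" if "alternating (x # s)" for s
    using assms(2-4) that
    by (cases "s = []") (auto simp: alternating_def successively_Cons successively_append_iff)
  ultimately have "alternating ([y1, y2, y3] @ (v @ u))" by blast
  then show ?thesis using alternating_rotate[of u "[y1, y2, y3] @ v"] by simp
qed

lemma eps_left_comm: "f * (eps a b * g) = eps a b * (f * g)"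
  by (simp add: eps_def)

lemma alt_supported_Q_letter:
  assumes "alternating (u @ x # v)"
  shows "alt_supported (mon u * Q_letter x * mon v)"
proof -
  note exp = alternating_expand[OF assms]
  have 1: "mon [y1, y2, y3] = gen y1 * gen y2 * gen y3" for y1 y2 y3 :: letter
    by (simp add: mon_mult)
  have *: "alt_supported (mon u * (eps a b * (mon [y1, y2, y3] * mon v)))"
    if "barred y1 = barred x" "barred y2 \<noteq> barred x" "barred y3 = barred x" for a b y1 y2 y3
    unfolding eps_left_comm mon_mult
    by (intro alt_supported_eps alt_supported_mon exp that)
  show ?thesis
    by (cases x)
       (auto simp: Lam_def Lam_tilde_def sum_distrib_left sum_distrib_right left_diff_distrib
          right_diff_distrib mult.assoc mon_mult eps_left_comm
          intro!: alt_supported_sum alt_supported_diff alt_supported_eps alt_supported_mon exp[simplified])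
qed

lemma alt_supported_Q_word:
  assumes "alternating w" shows "alt_supported (Q_word w)"
proof -
  have "alt_supported (mon u * der_word Q_letter v)" if "alternating (u @ v)" for u v
    using that
  proof (induction v arbitrary: u)
    case (Cons x v)
    have "mon u * der_word Q_letter (x # v) = mon u * Q_letter x * mon v
        + koszul (is_odd x) True * (mon (u @ [x]) * der_word Q_letter v)"
      unfolding mon_mult[symmetric] by (simp add: distrib_left mult.assoc koszul_def)
    then show ?case
      using alt_supported_Q_letter[OF Cons.prems] Cons.IH[of "u @ [x]"] Cons.prems
      by (auto simp: koszul_def intro!: alt_supported_add alt_supported_diff)
  qed simp
  from this[of "[]" w] assms show ?thesis by (simp add: Q_word_def)
qed

lemma eval_lin_trace:
  assumes "alt_supported f"
  shows "alg_hom eval_trace_word (lin_trace f) = (\<Sum>i\<in>UNIV. eval_entry i i f)"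
proof -
  have "alg_hom eval_trace_word (lin_trace f) =
      lin_ext (\<lambda>w. alg_hom eval_trace_word (word_trace w)) f"
    unfolding alg_hom_def
    by (induction f rule: free_alg_induct) (simp_all add: lin_ext_scale lin_ext_add lin_ext_cst_mon)
  also have "\<dots> = lin_ext (\<lambda>w. trace (word_matrix w)) f"
    unfolding lin_ext_def[of _ f]
  proof (intro sum.cong refl arg_cong2[where f = "(*)"])
    fix w assume "w \<in> Poly_Mapping.keys f"
    then have "alternating (letters w)"
      using assms by (cases w) (auto simp: alt_supported_def in_keys_iff)
    then show "alg_hom eval_trace_word (word_trace (letters w)) = trace (word_matrix (letters w))"
      by (simp add: word_trace_def alg_hom_def eval_trace_word_def Trace_word_inverse)
  qed
  also have "\<dots> = (\<Sum>i\<in>UNIV. eval_entry i i f)"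
    unfolding eval_entry_def
    by (induction f rule: free_alg_induct)
       (simp_all add: lin_ext_add lin_ext_cst_mon sum.distrib trace_def sum_distrib_left)
  finally show ?thesis .
qed

lemma eval_entry_mult: "eval_entry i j (f * g) = (\<Sum>k\<in>UNIV. eval_entry i k f * eval_entry k j g)"
proof (induction f rule: free_alg_induct)
  case (mon c w)
  show ?case
  proof (induction g rule: free_alg_induct)
    case (mon d v)
    show ?case
      unfolding cst_mon_mult eval_entry_def lin_ext_scale lin_ext_mon
      by (simp add: word_matrix_append matrix_matrix_mult_def sum_distrib_left mult.assoc
          cst_left_comm[of "word_matrix w $ i $ _"])
  qed (simp add: eval_entry_def lin_ext_add distrib_left sum.distrib)
qed (simp add: eval_entry_def lin_ext_add distrib_right sum.distrib)

lemma eval_entry_add: "eval_entry i j (f + g) = eval_entry i j f + eval_entry i j g"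
  and eval_entry_diff: "eval_entry i j (f - g) = eval_entry i j f - eval_entry i j g"
  by (simp_all add: eval_entry_def lin_ext_add lin_ext_diff)

lemma eval_entry_mon: "eval_entry i j (mon w) = word_matrix w $ i $ j"
  by (simp add: eval_entry_def)

lemma odd_der_word_matrix: "odd_der Q_entry (word_matrix w $ i $ j) = eval_entry i j (Q_word w)"
proof (induction w arbitrary: i)
  case Nil
  show ?case by (simp add: mat_def Q_word_def eval_entry_def odd_der_1) (simp add: odd_der_def)
next
  case (Cons x w)
  have "odd_der Q_entry (word_matrix (x # w) $ i $ j) =
      (\<Sum>k\<in>UNIV. odd_der Q_entry (gen (Entry x i k) * word_matrix w $ k $ j))"
    by (simp add: matrix_matrix_mult_def generic_matrix_def odd_der_def lin_ext_sum)
  also have "\<dots> = (\<Sum>k\<in>UNIV. eval_entry i k (Q_letter x) * word_matrix w $ k $ j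
      + koszul (is_odd x) True * (gen (Entry x i k) * eval_entry k j (Q_word w)))"
    by (simp add: gca.odd_der_gen_mult Cons.IH)
  also have "\<dots> = eval_entry i j (Q_word (x # w))"
    by (cases "is_odd x")
       (simp_all add: Q_word_def koszul_def eval_entry_mult eval_entry_mon sum.distrib
          sum_subtractf eval_entry_add eval_entry_diff generic_matrix_def)
  finally show ?case .
qed

lemma Q_matrix_ev: "Q_matrix (ev x :: 'n::finite entry gca) = ev (Q_formal x)"
proof -
  have t: "odd_der Q_entry (eval_trace_word t :: 'n entry free_alg) =
      alg_hom eval_trace_word (Q_trace_word t)" for t
    using letters_of[of t]
    by (simp add: Q_trace_word_def eval_lin_trace alt_supported_Q_word eval_trace_word_def
        trace_def odd_der_word_matrix odd_der_sum)
  have w: "odd_der Q_entry (prod_list (map eval_trace_word w) :: 'n entry free_alg) =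
      alg_hom eval_trace_word (der_word Q_trace_word w)" for w
  proof (induction w)
    case Nil
    show ?case by (simp add: odd_der_1 alg_hom_def)
  next
    case (Cons x w)
    have "alg_hom eval_trace_word (koszul p q) = (koszul p q :: 'n entry free_alg)" for p q
      by (simp add: alg_hom_def koszul_def lin_ext_uminus)
    moreover have "alg_hom eval_trace_word (mon v) =
        (prod_list (map eval_trace_word v) :: 'n entry free_alg)" for v
      by (simp add: alg_hom_def)
    moreover have "alg_hom eval_trace_word (f + g) = alg_hom eval_trace_word f +
        (alg_hom eval_trace_word g :: 'n entry free_alg)" for f g
      by (simp add: alg_hom_def lin_ext_add)
    ultimately show ?case
      by (simp add: odd_der_mult t Cons grade_inv_homog[OF homog_eval_trace_word] alg_hom_mult
          mult.assoc)
  qed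
  have "odd_der Q_entry (alg_hom eval_trace_word f :: 'n entry free_alg) =
      alg_hom eval_trace_word (odd_der Q_trace_word f)" for f
    using w unfolding odd_der_def alg_hom_def
    by (induction f rule: free_alg_induct) (simp_all add: lin_ext_scale lin_ext_add)
  then show ?thesis by transfer (simp add: ideal_gen.zero)
qed

section \<open>Monotone and exact operators\<close>

text \<open>
  The algebra at finite \<open>N\<close> is a subalgebra of the free graded-commutative algebra on the
  matrix entries. \<open>Q_matrix\<close>, the derivation defined on all entries, restricts to it by
  \<open>Q_matrix_ev\<close>.
\<close>

definition trace_algebra :: "'n::finite entry gca set" where
  "trace_algebra = range ev"

definition monotone_ops :: "'n::finite entry gca set" where
  "monotone_ops = ev ` {x. Q_formal x = 0}"

definition exact_ops :: "'n::finite entry gca set" where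
  "exact_ops = Q_matrix ` trace_algebra"

text \<open>\<open>O_op a b\<close> and \<open>T_op c d\<close> have upper index first, lower index second.\<close>

definition O_op :: "flavour \<Rightarrow> flavour \<Rightarrow> 2 entry gca" where
  "O_op a b = ev (
     (\<Sum>c\<in>UNIV. \<Sum>d\<in>UNIV. eps c d *
        (4 * Tr [psib c, phi d, phib a, phi b] - 3 * (Tr [psib c, phi d] * Tr [phib a, phi b])))
   - (\<Sum>c\<in>UNIV. \<Sum>d\<in>UNIV. eps c d *
        (4 * Tr [psi c, phib d, phi b, phib a] - 3 * (Tr [psi c, phib d] * Tr [phi b, phib a]))))"

definition T_op :: "flavour \<Rightarrow> flavour \<Rightarrow> 2 entry gca" where
  "T_op c d = ev (Tr [phib c, phi d])"

end

theory Submission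
  imports Defs "HOL-Library.List_Lexorder"
begin

text \<open>
  Since \<^const>\<open>Q_formal\<close> squares to zero, \<open>M\<^sub>2 + E\<^sub>2\<close> is the image under \<^const>\<open>ev\<close> of the formal kernel
  of \<open>Q\<close>.

  For the disallowed dressings one adds a combination of the trilinear trace relation of
  \<open>2 \<times> 2\<close> matrices (the polarised Cayley--Hamilton identity), which evaluates to zero, so that the
  sum becomes formally closed.

  For the allowed dressings one exhibits a linear functional \<open>\<lambda>\<close> on bosonic formal operators and a
  linear functional \<open>\<mu>\<close> on the algebra of matrix entries with \<open>\<mu> \<circ> ev = \<lambda> \<circ> Q\<close>. Then \<open>\<mu>\<close> vanishes on
  \<open>M\<^sub>2 + E\<^sub>2\<close>, but not on the dressed operator. Here \<open>\<lambda>\<close> is a table of coefficients of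
  multi-traces of fixed letter content, and \<open>\<mu>\<close> extracts the same content and substitutes integer
  \<open>2 \<times> 2\<close> matrices for all letters, which is consistent because at most one fermion occurs. The
  identity is homogeneous, so it only has to be checked on the finitely many multi-trace words of
  that content.
\<close>

section \<open>Linear functionals on presented algebras\<close>

text \<open>Scalars are embedded by \<open>cst\<close> and read off as the coefficient of the empty
  word, so that the facts on \<open>lin_ext\<close> carry over to functionals.\<close>

definition lin_fun :: "('x list \<Rightarrow> complex) \<Rightarrow> 'x free_alg \<Rightarrow> complex" where
  "lin_fun F f = Poly_Mapping.lookup (lin_ext (\<lambda>w. cst (F w) :: 'x free_alg) f) 0"

lemma lookup_cst_0 [simp]: "Poly_Mapping.lookup (cst c) 0 = c"
  by (simp add: cst_def)

lemma lin_fun_add: "lin_fun F (f + g) = lin_fun F f + lin_fun F g"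
  by (simp add: lin_fun_def lin_ext_add lookup_add)

lemma lin_fun_diff: "lin_fun F (f - g) = lin_fun F f - lin_fun F g"
  by (simp add: lin_fun_def lin_ext_diff lookup_minus)

lemma lin_fun_0 [simp]: "lin_fun F 0 = 0"
  by (simp add: lin_fun_def)

lemma lin_fun_scale: "lin_fun F (cst c * f) = c * lin_fun F f"
  by (simp add: lin_fun_def lin_ext_scale lookup_mult_0)

lemma lin_fun_mon [simp]: "lin_fun F (mon w) = F w"
  by (simp add: lin_fun_def)

lemma lin_fun_sum: "lin_fun F (sum f A) = (\<Sum>x\<in>A. lin_fun F (f x))"
  by (induction A rule: infinite_finite_induct) (simp_all add: lin_fun_add)

lemma lin_fun_mult:
  assumes "\<And>u v. F (u @ v) = F u * F v"
  shows "lin_fun F (f * g) = lin_fun F f * lin_fun F g"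
proof (induction f rule: free_alg_induct)
  case (mon c w)
  show ?case
  proof (induction g rule: free_alg_induct)
    case (mon d v)
    show ?case by (simp only: cst_mon_mult lin_fun_scale lin_fun_mon assms) simp
  qed (simp add: lin_fun_add distrib_left)
qed (simp add: lin_fun_add distrib_right)

lemma lin_fun_sum_weighted:
  "lin_fun (\<lambda>w. \<Sum>(k, G)\<leftarrow>L. k * G w) f = (\<Sum>(k, G)\<leftarrow>L. k * lin_fun G f)"
proof (induction f rule: free_alg_induct)
  case (mon c w)
  show ?case by (induction L) (auto simp: lin_fun_scale algebra_simps)
next
  case (add f g)
  have "(\<Sum>(k, G)\<leftarrow>L. k * lin_fun G (f + g)) = (\<Sum>(k, G)\<leftarrow>L. k * lin_fun G f) + (\<Sum>(k, G)\<leftarrow>L. k * lin_fun G g)"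
    by (induction L) (auto simp: lin_fun_add algebra_simps)
  with add show ?case by (simp add: lin_fun_add)
qed

text \<open>By linearity the two outer factors of a generator of the ideal may be taken to be
  monomials. This makes well-definedness on a quotient a condition on words.\<close>

lemma lin_fun_ideal:
  assumes "\<And>r u v. r \<in> R \<Longrightarrow> lin_fun F (mon u * r * mon v) = 0" and "f \<in> ideal_gen R"
  shows "lin_fun F f = 0"
  using assms(2)
proof (induction rule: ideal_gen.induct)
  case (gen r a b)
  show ?case
  proof (induction a rule: free_alg_induct)
    case (mon c u)
    show ?case
    proof (induction b rule: free_alg_induct)
      case (mon d v)
      have "cst c * mon u * r * (cst d * mon v) = cst c * (cst d * (mon u * r * mon v))"
        by (simp only: mult.assoc cst_left_comm[of r] cst_left_comm[of "mon u"])
      then show ?case by (simp add: lin_fun_scale assms(1)[OF gen])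
    qed (simp add: distrib_left lin_fun_add)
  qed (simp add: distrib_right lin_fun_add)
qed (simp_all add: lin_fun_add)

lemma cst_koszul: "cst (koszul p q) = (koszul p q :: 'a free_alg)"
proof -
  have "cst (- 1) + (1 :: 'a free_alg) = 0" using cst_add[of "- 1" 1] by simp
  then show ?thesis by (auto simp: koszul_def eq_neg_iff_add_eq_0)
qed

text \<open>Supercommutativity and supercyclicity relations are both differences of two monomials up
  to a Koszul sign, so this one evaluation serves for both.\<close>

lemma lin_fun_binomial:
  "lin_fun F (mon u * (mon p - koszul a b * mon q) * mon v) =
    F (u @ p @ v) - koszul a b * F (u @ q @ v)"
proof -
  have "mon u * (mon p - koszul a b * mon q) * mon v =
      mon u * mon p * mon v - cst (koszul a b) * (mon u * mon q * mon v)"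
    unfolding right_diff_distrib left_diff_distrib mult.assoc cst_koszul[symmetric]
      cst_left_comm[of "mon u"] ..
  then show ?thesis by (simp add: mon_mult lin_fun_diff lin_fun_scale)
qed

lemma lin_fun_supercomm:
  assumes "\<And>u x y v. F (u @ x # y # v) = koszul (is_odd x) (is_odd y) * F (u @ y # x # v)"
    and "r \<in> supercomm_rels"
  shows "lin_fun F (mon u * r * mon v) = 0"
proof -
  obtain x y where "r = mon [x, y] - koszul (is_odd x) (is_odd y) * mon [y, x]"
    using assms(2) by (auto simp: supercomm_rels_def mon_mult)
  then show ?thesis using assms(1)[of u x y v] by (simp add: lin_fun_binomial)
qed

section \<open>Gradings\<close>

definition graded_by :: "('x \<Rightarrow> 'g::monoid_add) \<Rightarrow> 'g \<Rightarrow> 'x free_alg \<Rightarrow> bool" where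
  "graded_by g n f \<longleftrightarrow> (\<forall>w. Poly_Mapping.lookup f (Word w) \<noteq> 0 \<longrightarrow> sum_list (map g w) = n)"

lemma graded_by_0 [simp]: "graded_by g n 0"
  by (simp add: graded_by_def)

lemma graded_by_add: "graded_by g n f \<Longrightarrow> graded_by g n f' \<Longrightarrow> graded_by g n (f + f')"
  unfolding graded_by_def lookup_add by (metis add.right_neutral)

lemma graded_by_uminus: "graded_by g n f \<Longrightarrow> graded_by g n (- f)"
  by (simp add: graded_by_def)

lemma graded_by_sum: "(\<And>x. x \<in> S \<Longrightarrow> graded_by g n (f x)) \<Longrightarrow> graded_by g n (sum f S)"
  by (induction S rule: infinite_finite_induct) (auto intro: graded_by_add)

lemma graded_by_cst_mon: "sum_list (map g w) = n \<Longrightarrow> graded_by g n (cst c * mon w)"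
  by (auto simp: graded_by_def cst_mon lookup_single when_def split: if_splits)

lemma graded_by_mon: "sum_list (map g w) = n \<Longrightarrow> graded_by g n (mon w)"
  using graded_by_cst_mon[of g w n 1] by simp

lemma graded_by_1: "graded_by g 0 1"
  using graded_by_mon[of g "[]" 0] by simp

lemma graded_by_induct [consumes 1, case_names zero mon add]:
  assumes "graded_by g n f" and "P 0" and "\<And>c w. sum_list (map g w) = n \<Longrightarrow> P (cst c * mon w)"
    and "\<And>f h. P f \<Longrightarrow> P h \<Longrightarrow> P (f + h)"
  shows "P f"
proof -
  have s: "P (Poly_Mapping.single w (Poly_Mapping.lookup f w))" for w
  proof (cases "Poly_Mapping.lookup f w = 0")
    case False
    then show ?thesis
      using assms(1) assms(3)[of "letters w" "Poly_Mapping.lookup f w"]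
      by (cases w) (auto simp: graded_by_def cst_mon)
  qed (simp add: assms(2))
  have "P (\<Sum>w\<in>S. Poly_Mapping.single w (Poly_Mapping.lookup f w))" if "finite S" for S
    using that by (induction S) (auto simp: s assms(2,4))
  from this[OF finite_keys[of f]] show ?thesis by (simp add: poly_mapping_sum_monomials)
qed

lemma graded_by_mult:
  assumes "graded_by g m f" "graded_by g n h" "k = m + n"
  shows "graded_by g k (f * h)"
  using assms(1)
proof (induction rule: graded_by_induct)
  case (mon c w)
  note w = mon
  show ?case using assms(2)
  proof (induction rule: graded_by_induct)
    case (mon d v)
    have "cst c * mon w * (cst d * mon v) = cst (c * d) * mon (w @ v)"
      unfolding cst_mon_mult cst_mult by (simp only: mult.assoc)
    then show ?case using graded_by_cst_mon[of g "w @ v" k "c * d"] w mon assms(3) by simp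
  qed (simp_all add: distrib_left graded_by_add)
qed (simp_all add: distrib_right graded_by_add)

lemma graded_by_koszul: "graded_by g n f \<Longrightarrow> graded_by g n (koszul a b * f)"
  by (simp add: koszul_def graded_by_uminus)

lemma graded_by_lin_ext:
  assumes "graded_by g n f" "\<And>w. sum_list (map g w) = n \<Longrightarrow> graded_by h m (k w)"
  shows "graded_by h m (lin_ext k f)"
  using assms(1)
proof (induction rule: graded_by_induct)
  case (mon c w)
  have "graded_by h 0 (cst c)" using graded_by_cst_mon[of h "[]" 0 c] by simp
  from graded_by_mult[OF this assms(2)[OF mon]] show ?case by (simp add: lin_ext_cst_mon)
qed (simp_all add: lin_ext_add graded_by_add)

text \<open>The shift \<open>s\<close> is the amount by which the derivation lowers the grade. Each
  Leibniz term replaces exactly one letter, so the shift is applied once per word.\<close>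

lemma graded_by_der_word:
  fixes g :: "'x::graded \<Rightarrow> 'g::ab_group_add"
  assumes "\<And>x. graded_by g (g x - s) (d x)" "n = sum_list (map g w) - s"
  shows "graded_by g n (der_word d w)"
  using assms(2)
proof (induction w arbitrary: n)
  case (Cons x w)
  have 1: "graded_by g n (d x * mon w)"
    by (rule graded_by_mult[OF assms(1) graded_by_mon[OF refl]]) (simp add: Cons.prems algebra_simps)
  have 2: "graded_by g n (koszul (is_odd x) True * (gen x * der_word d w))"
    by (intro graded_by_koszul graded_by_mult[OF graded_by_mon[OF refl] Cons.IH[OF refl]])
       (simp add: Cons.prems algebra_simps)
  show ?case using graded_by_add[OF 1 2] by (simp add: mult.assoc)
qed simp

lemma graded_by_prod_list:
  assumes "\<And>x. x \<in> set xs \<Longrightarrow> graded_by g (h x) (f x)"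
  shows "graded_by g (sum_list (map h xs)) (prod_list (map f xs))"
  using assms
proof (induction xs)
  case Nil
  then show ?case using graded_by_mon[of g "[]" 0] by simp
next
  case (Cons x xs)
  then show ?case by (auto intro!: graded_by_mult[of g "h x" _ "sum_list (map h xs)"])
qed

lemma lin_fun_graded_eq_0:
  assumes "graded_by g n f" "\<And>w. sum_list (map g w) = n \<Longrightarrow> F w = 0"
  shows "lin_fun F f = 0"
  using assms(1) by (induction rule: graded_by_induct) (simp_all add: lin_fun_scale lin_fun_add assms(2))

lemma lin_fun_graded_cong:
  assumes "graded_by g n f" "\<And>w. sum_list (map g w) = n \<Longrightarrow> F w = G w"
  shows "lin_fun F f = lin_fun G f"
  using assms(1) by (induction rule: graded_by_induct) (simp_all add: lin_fun_scale lin_fun_add assms(2))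

section \<open>Integer combinations\<close>

definition int_scale :: "int \<Rightarrow> (int \<times> 'a) list \<Rightarrow> (int \<times> 'a) list" where
  "int_scale k = map (map_prod ((*) k) id)"

definition int_bind :: "(int \<times> 'a) list \<Rightarrow> ('a \<Rightarrow> (int \<times> 'b) list) \<Rightarrow> (int \<times> 'b) list" where
  "int_bind P g = concat (map (\<lambda>(c, k). int_scale c (g k)) P)"

fun insert_term :: "int \<Rightarrow> 'a \<Rightarrow> (int \<times> 'a) list \<Rightarrow> (int \<times> 'a) list" where
  "insert_term c k [] = [(c, k)]"
| "insert_term c k ((d, l) # P) =
     (if k = l then if c + d = 0 then P else (c + d, l) # P else (d, l) # insert_term c k P)"

text \<open>Like terms are merged and cancelled ones dropped, so the result \<open>[]\<close> is an
  executable proof that a combination vanishes under every interpretation of its keys.\<close>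

fun collect_terms :: "(int \<times> 'a) list \<Rightarrow> (int \<times> 'a) list" where
  "collect_terms [] = []"
| "collect_terms ((c, k) # P) = insert_term c k (collect_terms P)"

definition int_comb :: "('k \<Rightarrow> 'a::ring_1) \<Rightarrow> (int \<times> 'k) list \<Rightarrow> 'a" where
  "int_comb F P = (\<Sum>(c, k)\<leftarrow>P. of_int c * F k)"

lemma int_comb_Nil [simp]: "int_comb F [] = 0"
  and int_comb_Cons [simp]: "int_comb F ((c, k) # P) = of_int c * F k + int_comb F P"
  and int_comb_append [simp]: "int_comb F (P @ P') = int_comb F P + int_comb F P'"
  by (simp_all add: int_comb_def)

lemma int_comb_scale [simp]: "int_comb F (int_scale c P) = of_int c * int_comb F P"
  by (induction P) (auto simp: int_scale_def distrib_left mult.assoc)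

lemma int_comb_bind: "int_comb F (int_bind P g) = int_comb (\<lambda>k. int_comb F (g k)) P"
  by (induction P) (auto simp: int_bind_def)

lemma int_comb_map_apsnd [simp]: "int_comb F (map (apsnd g) P) = int_comb (\<lambda>k. F (g k)) P"
  by (induction P) auto

lemma int_comb_cong: "(\<And>c k. (c, k) \<in> set P \<Longrightarrow> F k = G k) \<Longrightarrow> int_comb F P = int_comb G P"
  unfolding int_comb_def by (intro arg_cong[where f = sum_list] map_cong) auto

text \<open>Integer multiples arise from repeated addition and negation, so additivity alone moves
  \<open>ev\<close>, \<open>Q_formal\<close> and the two functionals through an
  \<open>int_comb\<close>.\<close>

lemma additive_of_int_mult:
  fixes h :: "'a::ring_1 \<Rightarrow> 'b::ring_1"
  assumes add: "\<And>x y. h (x + y) = h x + h y"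
  shows "h (of_int c * x) = of_int c * h x"
proof -
  have 0: "h 0 = 0" using add[of 0 0] by simp
  have m: "h (- y) = - h y" for y using add[of y "- y"] 0 by (simp add: minus_unique)
  have n: "h (of_nat n * y) = of_nat n * h y" for n y
    by (induction n) (simp_all add: 0 add distrib_right)
  show ?thesis by (cases c rule: int_cases2) (simp_all add: n m)
qed

lemma additive_int_comb:
  fixes h :: "'a::ring_1 \<Rightarrow> 'b::ring_1"
  assumes "\<And>x y. h (x + y) = h x + h y"
  shows "h (int_comb F P) = int_comb (\<lambda>k. h (F k)) P"
proof (induction P)
  case Nil
  show ?case using assms[of 0 0] by simp
qed (auto simp: assms additive_of_int_mult[of h, OF assms])

lemma cst_of_int: "cst (of_int c) = of_int c"
  using additive_of_int_mult[of cst c 1, OF cst_add] by simp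

lemma of_int_comb: "of_int (\<Sum>(c, k)\<leftarrow>P. c * F k) = (\<Sum>(c, k)\<leftarrow>P. of_int c * of_int (F k))"
  by (induction P) auto

lemma int_comb_mult_left: "int_comb (\<lambda>k. a * F k) P = a * int_comb F P"
  by (rule additive_int_comb[symmetric]) (rule distrib_left)

lemma int_comb_mult_right: "int_comb (\<lambda>k. F k * a) P = int_comb F P * a"
  by (rule additive_int_comb[symmetric]) (rule distrib_right)

lemma int_comb_insert_term: "int_comb F (insert_term c k P) = of_int c * F k + int_comb F P"
proof (induction c k P rule: insert_term.induct)
  case (2 c k d l P)
  have "of_int c * F k + of_int d * F k = 0" if "c + d = 0"
    using that by (simp flip: distrib_right of_int_add)
  with 2 show ?case by (auto simp: distrib_right algebra_simps)
qed simp

lemma int_comb_collect_terms: "int_comb F (collect_terms P) = int_comb F P"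
  by (induction P rule: collect_terms.induct) (simp_all add: int_comb_insert_term)

section \<open>The supercharge on multi-trace expressions\<close>

type_synonym trace_poly = "(int \<times> letter list list) list"

text \<open>The numbering is arbitrary but injective. It supplies the order behind the canonical
  forms, and its case rule splits a letter into all twelve possibilities.\<close>

fun letter_rank :: "letter \<Rightarrow> int" where
  "letter_rank (phi F1) = 0" | "letter_rank (phi F2) = 1"
| "letter_rank (phib F1) = 2" | "letter_rank (phib F2) = 3"
| "letter_rank (psi F1) = 4" | "letter_rank (psi F2) = 5"
| "letter_rank (psib F1) = 6" | "letter_rank (psib F2) = 7"
| "letter_rank (Dphi F1) = 8" | "letter_rank (Dphi F2) = 9"
| "letter_rank (Dphib F1) = 10" | "letter_rank (Dphib F2) = 11"

lemma inj_letter_rank: "letter_rank x = letter_rank y \<Longrightarrow> x = y"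
  by (cases x rule: letter_rank.cases; cases y rule: letter_rank.cases) simp_all

instantiation letter :: linorder
begin
definition less_eq_letter :: "letter \<Rightarrow> letter \<Rightarrow> bool" where "x \<le> y \<longleftrightarrow> letter_rank x \<le> letter_rank y"
definition less_letter :: "letter \<Rightarrow> letter \<Rightarrow> bool" where "x < y \<longleftrightarrow> letter_rank x < letter_rank y"
instance by standard (auto simp: less_eq_letter_def less_letter_def inj_letter_rank)
end

section \<open>Executable form of the supercharge\<close>

fun Q_terms :: "letter \<Rightarrow> (int \<times> letter list) list" where
  "Q_terms (psi a) = [(1, [phi F1, phib a, phi F2]), (-1, [phi F2, phib a, phi F1])]"
| "Q_terms (psib a) = [(1, [phib F1, phi a, phib F2]), (-1, [phib F2, phi a, phib F1])]"
| "Q_terms (Dphi e) =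
    [(1, [phi e, psib F1, phi F2]), (-1, [phi e, psib F2, phi F1]),
     (-1, [phi e, phib F1, psi F2]), (1, [phi e, phib F2, psi F1]),
     (-1, [psi F1, phib F2, phi e]), (1, [psi F2, phib F1, phi e]),
     (1, [phi F1, psib F2, phi e]), (-1, [phi F2, psib F1, phi e])]"
| "Q_terms (Dphib e) =
    [(1, [phib e, psi F1, phib F2]), (-1, [phib e, psi F2, phib F1]),
     (-1, [phib e, phi F1, psib F2]), (1, [phib e, phi F2, psib F1]),
     (-1, [psib F1, phi F2, phib e]), (1, [psib F2, phi F1, phib e]),
     (1, [phib F1, psi F2, phib e]), (-1, [phib F2, psi F1, phib e])]"
| "Q_terms (phi a) = []"
| "Q_terms (phib a) = []"

fun Q_expand :: "letter list \<Rightarrow> (int \<times> letter list) list" where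
  "Q_expand [] = []"
| "Q_expand (x # w) = map (apsnd (\<lambda>u. u @ w)) (Q_terms x) @
     map (map_prod (\<lambda>c. if is_odd x then - c else c) ((#) x)) (Q_expand w)"

fun Q_expands :: "letter list list \<Rightarrow> trace_poly" where
  "Q_expands [] = []"
| "Q_expands (w # ws) = map (apsnd (\<lambda>u. u # ws)) (Q_expand w) @
     map (map_prod (\<lambda>c. if odd_word w then - c else c) ((#) w)) (Q_expands ws)"

definition tr_prod :: "letter list list \<Rightarrow> formal_op" where
  "tr_prod ws = prod_list (map Tr ws)"

lemma tr_prod_Nil [simp]: "tr_prod [] = 1"
  and tr_prod_Cons: "tr_prod (w # ws) = Tr w * tr_prod ws"
  by (simp_all add: tr_prod_def)

lemma Tr_eq: "Tr w = abs_formal_op (word_trace w)"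
  by (simp add: Tr.abs_eq)

lemma tr_prod_trace_words: "tr_prod (map letters_of ts) = abs_formal_op (mon ts)"
proof (induction ts)
  case Nil
  show ?case by (simp add: formal.proj_1)
next
  case (Cons t ts)
  have "abs_formal_op (mon (t # ts)) = abs_formal_op (gen t) * abs_formal_op (mon ts)"
    by (simp add: mon_mult flip: formal.proj_mult)
  with Cons show ?case
    using letters_of[of t] by (simp add: tr_prod_Cons Tr_eq word_trace_def letters_of_inverse)
qed

lemma Q_letter_terms: "Q_letter x = int_comb mon (Q_terms x)"
  by (cases x) (simp_all add: Lam_def Lam_tilde_def UNIV_flavour eps_def mon_mult algebra_simps)

lemma Q_word_expand: "Q_word w = int_comb mon (Q_expand w)"
proof (induction w)
  case (Cons x w)
  have s: "int_comb F (map (map_prod (\<lambda>c. if is_odd x then - c else c) ((#) x)) P) =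
      koszul (is_odd x) True * int_comb (\<lambda>u. F (x # u)) P" for F :: "letter list \<Rightarrow> letter free_alg" and P
    by (induction P) (auto simp: koszul_def)
  have "Q_word (x # w) = int_comb (\<lambda>u. mon (u @ w)) (Q_terms x) +
      koszul (is_odd x) True * int_comb (\<lambda>u. mon (x # u)) (Q_expand w)"
    using Cons
    by (simp add: Q_word_def Q_letter_terms mon_mult mult.assoc flip: int_comb_mult_left int_comb_mult_right)
  then show ?case by (simp add: s)
qed (simp add: Q_word_def)

text \<open>The square of an odd derivation is again a derivation: the two mixed terms carry
  opposite signs because the derivation flips parity. Hence it is determined by its values on
  generators.\<close>

lemma odd_der_square_eq_0:
  assumes h: "\<And>x. homog (\<not> is_odd x) (d x)" and sq: "\<And>x. odd_der d (d x) = 0"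
  shows "odd_der d (odd_der d f) = 0"
proof -
  have w: "odd_der d (der_word d w) = 0" for w
  proof (induction w)
    case (Cons x w)
    have "odd_der d (der_word d (x # w)) = odd_der d (d x * mon w)
        + koszul (is_odd x) True * odd_der d (gen x * der_word d w)"
      by (simp add: odd_der_def lin_ext_add lin_ext_koszul mult.assoc)
    also have "\<dots> = 0"
      by (simp add: odd_der_mult grade_inv_homog[OF h] grade_inv_homog[OF homog_mon[OF refl]]
          sq Cons koszul_def)
         (simp add: odd_der_def)
    finally show ?case .
  qed (simp add: odd_der_def)
  show ?thesis
    by (induction f rule: free_alg_induct)
       (use w in \<open>simp_all add: odd_der_def lin_ext_scale lin_ext_add\<close>)
qed

lemma odd_der_lin_trace:
  assumes "alt_supported f"
  shows "odd_der Q_trace_word (lin_trace f) = lin_trace (odd_der Q_letter f)"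
proof -
  have "odd_der Q_trace_word (lin_trace f) = (\<Sum>w\<in>Poly_Mapping.keys f.
      cst (Poly_Mapping.lookup f w) * odd_der Q_trace_word (word_trace (letters w)))"
    by (simp add: lin_ext_def[of word_trace] odd_der_sum) (simp add: odd_der_def lin_ext_scale)
  also have "\<dots> = (\<Sum>w\<in>Poly_Mapping.keys f.
      cst (Poly_Mapping.lookup f w) * lin_trace (Q_word (letters w)))"
  proof (intro sum.cong refl arg_cong2[where f = "(*)"] odd_der_Q_word_trace)
    fix w assume "w \<in> Poly_Mapping.keys f"
    then show "alternating (letters w)"
      using assms by (cases w) (auto simp: alt_supported_def in_keys_iff)
  qed
  also have "\<dots> = lin_trace (odd_der Q_letter f)"
    by (simp add: odd_der_def lin_ext_def[of "der_word _"] lin_ext_sum lin_ext_scale Q_word_def)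
  finally show ?thesis .
qed

text \<open>The derivation principle is used twice, first for letters inside a word and then for
  traces inside a product. The passage between the two levels is
  \<open>odd_der_lin_trace\<close>.\<close>

lemma Q_formal_square:
  assumes "\<And>x. odd_der Q_letter (Q_letter x) = 0"
  shows "Q_formal (Q_formal x) = 0"
proof -
  have 0: "odd_der Q_letter (Q_word w) = 0" for w
    using odd_der_square_eq_0[OF homog_Q_letter assms, of "mon w"]
    by (simp add: odd_der_def Q_word_def)
  have "odd_der Q_trace_word (Q_trace_word t) = 0" for t
    using letters_of[of t] by (simp add: Q_trace_word_def odd_der_lin_trace alt_supported_Q_word 0)
  then have "odd_der Q_trace_word (odd_der Q_trace_word f) = 0" for f
    by (intro odd_der_square_eq_0 homog_Q_trace_word)
  then show ?thesis by transfer (simp add: ideal_gen.zero)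
qed

text \<open>On single letters all terms cancel already in the free associative algebra, before
  cyclicity of the trace is imposed, so plain evaluation decides the twelve cases.\<close>

lemma collect_Q_terms_expand: "collect_terms (int_bind (Q_terms x) Q_expand) = []"
proof -
  have "list_all (\<lambda>x. collect_terms (int_bind (Q_terms x) Q_expand) = [])
      [phi F1, phi F2, psi F1, psi F2, Dphi F1, Dphi F2,
       phib F1, phib F2, psib F1, psib F2, Dphib F1, Dphib F2]"
    by code_simp
  then show ?thesis by (cases x rule: letter_rank.cases) (simp_all only: list.pred_inject simp_thms)
qed

lemma Q_letter_square: "odd_der Q_letter (Q_letter x) = 0"
proof -
  have "odd_der Q_letter (Q_letter x) = int_comb (\<lambda>w. odd_der Q_letter (mon w)) (Q_terms x)"
    unfolding Q_letter_terms by (rule additive_int_comb) (simp add: odd_der_def lin_ext_add)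
  also have "\<dots> = int_comb (\<lambda>w. int_comb mon (Q_expand w)) (Q_terms x)"
    by (simp add: odd_der_def flip: Q_word_def Q_word_expand)
  also have "\<dots> = int_comb mon (collect_terms (int_bind (Q_terms x) Q_expand))"
    by (simp only: int_comb_collect_terms int_comb_bind)
  finally show ?thesis by (simp only: collect_Q_terms_expand int_comb_Nil)
qed

lemma Q_formal_nilpotent: "Q_formal (Q_formal x) = 0"
  by (rule Q_formal_square[OF Q_letter_square])

section \<open>Additivity and Leibniz rule for the formal supercharge\<close>

lemma Q_formal_add: "Q_formal (x + y) = Q_formal x + Q_formal y"
  by transfer (simp add: odd_der_def lin_ext_add ideal_gen.zero)

lemma Q_formal_Tr_mult:
  assumes "alternating w"
  shows "Q_formal (Tr w * z) = int_comb Tr (Q_expand w) * z + koszul (odd_word w) True * (Tr w * Q_formal z)"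
proof -
  have 1: "abs_formal_op (lin_trace (Q_word w)) = int_comb Tr (Q_expand w)"
    unfolding Q_word_expand
    by (subst additive_int_comb[where h = "\<lambda>f. abs_formal_op (lin_trace f)"])
       (simp_all add: lin_ext_add formal.proj_add flip: Tr_eq)
  obtain f where z: "z = abs_formal_op f" using formal_op.abs_induct[of "\<lambda>z. \<exists>f. z = abs_formal_op f" z] by blast
  have "Q_formal (Tr w * z) = abs_formal_op (odd_der Q_trace_word (word_trace w * f))"
    unfolding Tr_eq z formal.proj_mult[symmetric] Q_formal.abs_eq ..
  also have "odd_der Q_trace_word (word_trace w * f) = lin_trace (Q_word w) * f
      + koszul (odd_word w) True * (word_trace w * odd_der Q_trace_word f)"
    by (simp add: odd_der_mult odd_der_Q_word_trace[OF assms] mult.assoc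
        grade_inv_homog[OF homog_word_trace[OF refl]])
  finally show ?thesis
    by (simp add: 1 z formal.proj_add formal.proj_mult formal.proj_koszul_1 Tr_eq Q_formal.abs_eq mult.assoc)
qed

lemma Q_formal_tr_prod:
  "list_all alternating ws \<Longrightarrow> Q_formal (tr_prod ws) = int_comb tr_prod (Q_expands ws)"
proof (induction ws)
  case Nil
  have "Q_formal 1 = 0" by transfer (simp add: odd_der_1 ideal_gen.zero)
  then show ?case by simp
next
  case (Cons w ws)
  have s: "int_comb tr_prod (map (map_prod (\<lambda>c. if odd_word w then - c else c) ((#) w)) P) =
      koszul (odd_word w) True * (Tr w * int_comb tr_prod P)" for P
    by (induction P) (auto simp: koszul_def tr_prod_Cons distrib_left int_comb_def
        mult_of_int_commute simp flip: mult.assoc)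
  from Cons show ?case
    by (simp add: tr_prod_Cons Q_formal_Tr_mult s int_comb_mult_right)
qed

lemma Q_formal_comb:
  assumes "list_all (\<lambda>(c, ws). list_all alternating ws) P"
  shows "Q_formal (int_comb tr_prod P) = int_comb tr_prod (int_bind P Q_expands)"
  unfolding additive_int_comb[of Q_formal, OF Q_formal_add] int_comb_bind
  by (rule int_comb_cong) (use assms in \<open>auto simp: list_all_iff Q_formal_tr_prod\<close>)

section \<open>Canonical forms\<close>

definition rotations :: "'a list \<Rightarrow> 'a list list" where
  "rotations w = map (\<lambda>n. drop n w @ take n w) [0..<length w]"

text \<open>The lexicographically least rotation represents a cyclic word. Signs are ignored, so
  this is a normal form of the trace only for bosonic words. The empty word is separated because it
  has an empty list of rotations, for which \<open>Min\<close> would be unspecified.\<close>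

definition canon :: "letter list \<Rightarrow> letter list" where
  "canon w = (if w = [] then [] else Min (set (rotations w)))"

definition canon_words :: "letter list list \<Rightarrow> letter list list" where
  "canon_words ws = sort (map canon ws)"

lemma set_rotations:
  assumes "w \<noteq> []" shows "set (rotations w) = range (\<lambda>n. rotate n w)"
proof -
  have "rotate n w \<in> set (rotations w)" for n
    using assms by (auto simp: rotations_def rotate_drop_take)
  moreover have "drop n w @ take n w = rotate n w" if "n < length w" for n
    using that by (simp add: rotate_drop_take)
  ultimately show ?thesis by (auto simp: rotations_def)
qed

lemma rotations_Nil_iff [simp]: "rotations w = [] \<longleftrightarrow> w = []"
  by (simp add: rotations_def)

lemma canon_rotate1: "canon (rotate1 w) = canon w"
proof (cases "w = []")
  case False
  \<comment> \<open>This undoes one rotation step. The full turn \<open>length w\<close> is added so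
    that the subtraction on natural numbers is not truncated at \<open>n = 0\<close>.\<close>
  have "rotate n w = rotate (n + length w - 1) (rotate1 w)" for n
  proof -
    have "rotate (n + length w - 1) (rotate1 w) = rotate (n + length w - 1 + 1) w"
      by (simp only: rotate_rotate[symmetric] rotate1_rotate_swap) simp
    also have "\<dots> = rotate n w"
      using False by (simp add: rotate_drop_take)
    finally show ?thesis ..
  qed
  then have "range (\<lambda>n. rotate n w) \<subseteq> range (\<lambda>n. rotate n (rotate1 w))" by blast
  moreover have "rotate n (rotate1 w) = rotate (Suc n) w" for n
    by (simp add: rotate1_rotate_swap)
  then have "range (\<lambda>n. rotate n (rotate1 w)) \<subseteq> range (\<lambda>n. rotate n w)" by blast
  ultimately have "range (\<lambda>n. rotate n (rotate1 w)) = range (\<lambda>n. rotate n w)" by blast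
  then show ?thesis
    using False set_rotations[OF False] set_rotations[of "rotate1 w"]
    by (simp only: canon_def rotate1_is_Nil_conv if_False simp_thms)
qed simp

lemma canon_rotation: "\<exists>n. canon w = rotate n w"
proof (cases "w = []")
  case False
  then have "Min (set (rotations w)) \<in> range (\<lambda>n. rotate n w)"
    unfolding set_rotations[OF False, symmetric] by (intro Min_in) simp_all
  then show ?thesis unfolding canon_def using False by (simp only: if_False image_iff) blast
qed (simp add: canon_def)

section \<open>Sign-free rotation and reordering of bosonic traces\<close>

abbreviation bosonic :: "letter list \<Rightarrow> bool" where "bosonic \<equiv> list_all (\<lambda>x. \<not> is_odd x)"

lemma Tr_append: "Tr (u @ v) = koszul (odd_word u) (odd_word v) * Tr (v @ u)"
  unfolding Tr_eq by (rule formal_trace_append)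

lemma Tr_comm: "Tr u * Tr v = koszul (odd_word u) (odd_word v) * (Tr v * Tr u)"
  unfolding Tr_eq by (rule formal.proj_homog_comm) (simp_all add: homog_word_trace)

lemma bosonic_not_odd: "bosonic w \<Longrightarrow> \<not> odd_word w"
  by (induction w) (simp_all add: odd_word_Cons)

lemma Tr_rotate: "bosonic w \<Longrightarrow> Tr (rotate n w) = Tr w"
proof -
  assume b: "bosonic w"
  define u v where "u = take (n mod length w) w" and "v = drop (n mod length w) w"
  have w: "w = u @ v" by (simp add: u_def v_def)
  have "\<not> odd_word u" using b unfolding w by (intro bosonic_not_odd) simp
  then have "Tr (u @ v) = Tr (v @ u)" by (simp add: Tr_append[of u] koszul_def)
  moreover have "rotate n w = v @ u" unfolding u_def v_def by (rule rotate_drop_take)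
  ultimately show ?thesis by (simp only: w)
qed

lemma bosonic_rotate: "bosonic w \<Longrightarrow> bosonic (rotate n w)"
  by (simp add: list_all_iff)

lemma Tr_canon: "bosonic w \<Longrightarrow> Tr (canon w) = Tr w"
  using canon_rotation[of w] by (auto simp: Tr_rotate)

lemma tr_prod_insort:
  "list_all bosonic (w # ws) \<Longrightarrow> tr_prod (insort w ws) = Tr w * tr_prod ws"
proof (induction ws)
  case (Cons v ws)
  have c: "Tr v * (Tr w * z) = Tr w * (Tr v * z)" for z
  proof -
    have "\<not> odd_word v" using Cons.prems by (simp add: bosonic_not_odd)
    then have "Tr v * Tr w = Tr w * Tr v" using Tr_comm[of v w] by (simp add: koszul_def)
    then show ?thesis by (simp only: mult.assoc[symmetric])
  qed
  have "tr_prod (insort w ws) = Tr w * tr_prod ws" using Cons by simp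
  then show ?case by (simp add: tr_prod_Cons c)
qed (simp add: tr_prod_Cons)

lemma tr_prod_canon_words:
  "list_all bosonic ws \<Longrightarrow> tr_prod (canon_words ws) = tr_prod ws"
proof (induction ws)
  case (Cons w ws)
  have b: "bosonic v \<Longrightarrow> bosonic (canon v)" for v
    using canon_rotation[of v] bosonic_rotate by metis
  have "list_all bosonic (canon w # sort (map canon ws))"
    using Cons.prems b by (auto simp: list_all_iff)
  with Cons show ?case
    by (simp add: canon_words_def tr_prod_insort tr_prod_Cons Tr_canon)
qed (simp add: canon_words_def)

text \<open>An executable criterion for formal closedness: expand \<open>Q\<close>, normalise each
  term and cancel. The second hypothesis guarantees that normalising produces no sign.\<close>

lemma Q_formal_eq_0:
  assumes "list_all (\<lambda>(c, ws). list_all alternating ws) P"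
    and "list_all (\<lambda>(c, ws). list_all bosonic ws) (int_bind P Q_expands)"
    and "collect_terms (map (apsnd canon_words) (int_bind P Q_expands)) = []"
  shows "Q_formal (int_comb tr_prod P) = 0"
proof -
  have "int_comb tr_prod (int_bind P Q_expands) = int_comb (\<lambda>ws. tr_prod (canon_words ws)) (int_bind P Q_expands)"
    by (rule int_comb_cong) (use assms(2) in \<open>auto simp: list_all_iff tr_prod_canon_words\<close>)
  also have "\<dots> = int_comb tr_prod (collect_terms (map (apsnd canon_words) (int_bind P Q_expands)))"
    by (simp add: int_comb_collect_terms)
  finally show ?thesis by (simp add: Q_formal_comb[OF assms(1)] assms(3))
qed

section \<open>Trace relations\<close>

lemma ev_add: "ev (x + y) = ev x + ev y"
  by transfer (simp add: alg_hom_def lin_ext_add ideal_gen.zero)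

lemma ev_mult: "ev (x * y) = ev x * ev y"
  by transfer (simp add: alg_hom_mult ideal_gen.zero)

lemma ev_Tr:
  assumes "alternating w"
  shows "ev (Tr w) = (trace (\<chi> i j. abs_gca (word_matrix w $ i $ j)) :: 'n::finite entry gca)"
proof -
  have "ev (Tr w) = (abs_gca (alg_hom eval_trace_word (word_trace w)) :: 'n entry gca)"
    by (simp add: Tr_eq ev.abs_eq)
  then show ?thesis
    using assms by (simp add: word_trace_def alg_hom_def eval_trace_word_def Trace_word_inverse trace_def gca.proj_sum)
qed

text \<open>Antisymmetrising over three indices gives zero in dimension two. The matrix
  \<open>U\<close> stands leftmost in every term, so only entries of \<open>V\<close> and
  \<open>W\<close> must be exchanged, and \<open>U\<close> may be odd.\<close>

lemma matrix_trace_relation: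
  fixes U V W :: "'a::ring_1 ^ 2 ^ 2"
  assumes "\<And>i j k l. W $ i $ j * V $ k $ l = V $ k $ l * W $ i $ j"
  shows "trace U * trace V * trace W + trace (U ** V ** W) + trace (U ** W ** V) =
    trace (U ** V) * trace W + trace (U ** W) * trace V + trace U * trace (V ** W)"
  unfolding trace_def matrix_matrix_mult_def vec_lambda_beta sum_2 distrib_left distrib_right
    mult.assoc assms
  by (simp only: add_ac)

text \<open>The six terms correspond to the permutations of three objects: each cycle becomes one
  trace, and the coefficient is the sign of the permutation.\<close>

definition trace_relation :: "letter list \<Rightarrow> letter list \<Rightarrow> letter list \<Rightarrow> trace_poly" where
  "trace_relation u v w =
    [(1, [u, v, w]), (-1, [u @ v, w]), (-1, [u @ w, v]), (-1, [u, v @ w]),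
     (1, [u @ v @ w]), (1, [u @ w @ v])]"

text \<open>Entries of a bosonic word are even and hence commute with those of any word, which is
  the commutation that \<open>matrix_trace_relation\<close> asks for.\<close>

lemma ev_trace_relation:
  assumes "list_all (\<lambda>(c, ws). list_all alternating ws) (trace_relation u v w)" "bosonic v" 
  shows "ev (int_comb tr_prod (trace_relation u v w)) = (0 :: 2 entry gca)"
proof -
  define M where "M w = ((\<chi> i j. abs_gca (word_matrix w $ i $ j)) :: 2 entry gca ^ 2 ^ 2)" for w
  have M: "M (w @ w') = M w ** M w'" for w w'
    by (simp add: M_def word_matrix_append matrix_matrix_mult_def vec_eq_iff gca.proj_sum gca.proj_mult)
  have ev: "ev (Tr w) = trace (M w)" if "alternating w" for w
    unfolding M_def by (rule ev_Tr[OF that])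
  have ev_uminus: "(ev (- x) :: 2 entry gca) = - ev x" for x
    using additive_of_int_mult[of ev "- 1" x, OF ev_add] by simp
  have ev_diff: "(ev (x - y) :: 2 entry gca) = ev x - ev y" for x y
    by (simp only: diff_conv_add_uminus ev_add ev_uminus)
  have "M w $ i $ j * M v $ k $ l = M v $ k $ l * M w $ i $ j" for i j k l
    using gca.proj_homog_comm[OF homog_word_matrix[OF refl, of w i j] homog_word_matrix[OF refl, of v k l]]
      bosonic_not_odd[OF assms(2)] by (simp add: M_def koszul_def)
  from matrix_trace_relation[OF this, of "M u"] show ?thesis
    using assms(1)
    by (simp add: trace_relation_def tr_prod_Cons ev_add ev_mult ev_uminus ev_diff ev M matrix_mul_assoc
        mult.assoc algebra_simps)
qed

section \<open>Degree and content\<close>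

text \<open>
  A fermion is given the content of the three bosons into which \<open>Q\<close> maps it, and likewise for the
  covariant derivatives, so that \<open>Q\<close> preserves the content and lowers the degree by one.
\<close>

type_synonym content = "int \<times> int \<times> int \<times> int"

fun letter_grade :: "letter \<Rightarrow> int \<times> content" where
  "letter_grade (phi a) = (0, of_bool (a = F1), of_bool (a = F2), 0, 0)"
| "letter_grade (phib a) = (0, 0, 0, of_bool (a = F1), of_bool (a = F2))"
| "letter_grade (psi a) = (1, 1, 1, of_bool (a = F1), of_bool (a = F2))"
| "letter_grade (psib a) = (1, of_bool (a = F1), of_bool (a = F2), 1, 1)"
| "letter_grade (Dphi a) = (2, 1 + of_bool (a = F1), 1 + of_bool (a = F2), 1, 1)"
| "letter_grade (Dphib a) = (2, 1, 1, 1 + of_bool (a = F1), 1 + of_bool (a = F2))"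

definition word_grade :: "letter list \<Rightarrow> int \<times> content" where
  "word_grade w = sum_list (map letter_grade w)"

definition words_grade :: "letter list list \<Rightarrow> int \<times> content" where
  "words_grade ws = sum_list (map word_grade ws)"

lemma fst_sum_list: "fst (sum_list xs) = sum_list (map fst xs)"
  by (induction xs) simp_all

lemma degree_nonneg: "0 \<le> fst (letter_grade x)" and degree_odd: "is_odd x \<Longrightarrow> fst (letter_grade x) = 1"
  by (cases x; simp)+

lemma word_grade_Nil [simp]: "word_grade [] = 0"
  and word_grade_Cons [simp]: "word_grade (x # w) = letter_grade x + word_grade w"
  and word_grade_append [simp]: "word_grade (u @ v) = word_grade u + word_grade v"
  by (simp_all add: word_grade_def)

lemma words_grade_Nil [simp]: "words_grade [] = 0"
  and words_grade_Cons [simp]: "words_grade (w # ws) = word_grade w + words_grade ws"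
  and words_grade_append [simp]: "words_grade (us @ vs) = words_grade us + words_grade vs"
  by (simp_all add: words_grade_def)

lemma word_degree_nonneg: "0 \<le> fst (word_grade w)"
  by (induction w) (simp_all add: degree_nonneg)

lemma words_degree_nonneg: "0 \<le> fst (words_grade ws)"
  by (induction ws) (simp_all add: word_degree_nonneg)

lemma word_degree_0: "fst (word_grade w) = 0 \<longleftrightarrow> (\<forall>x\<in>set w. fst (letter_grade x) = 0)"
  by (induction w) (auto simp: add_nonneg_eq_0_iff degree_nonneg word_degree_nonneg)

lemma words_degree_0: "fst (words_grade ws) = 0 \<longleftrightarrow> (\<forall>w\<in>set ws. fst (word_grade w) = 0)"
  by (induction ws) (auto simp: add_nonneg_eq_0_iff word_degree_nonneg words_degree_nonneg)

lemma bosonic_degree_0: "fst (word_grade w) = 0 \<Longrightarrow> bosonic w"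
  using degree_odd by (fastforce simp: word_degree_0 list_all_iff)

fun entry_grade :: "'n entry \<Rightarrow> int \<times> content" where
  "entry_grade (Entry x i j) = letter_grade x"

lemma graded_word_matrix: "graded_by entry_grade (word_grade w) (word_matrix w $ i $ j)"
proof (induction w arbitrary: i)
  case Nil
  then show ?case by (simp add: mat_def graded_by_1)
next
  case (Cons x w)
  have "graded_by entry_grade (letter_grade x) (gen (Entry x i k))" for k
    by (rule graded_by_mon) simp
  then show ?case
    by (auto simp: matrix_matrix_mult_def generic_matrix_def
        intro!: graded_by_sum graded_by_mult[OF _ Cons.IH])
qed

lemma graded_eval_trace_word: "graded_by entry_grade (word_grade (letters_of t)) (eval_trace_word t)"
  by (simp add: eval_trace_word_def trace_def graded_by_sum graded_word_matrix)

lemma graded_int_comb: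
  assumes "\<And>c k. (c, k) \<in> set P \<Longrightarrow> graded_by g n (F k)"
  shows "graded_by g n (int_comb F P)"
  using assms
proof (induction P)
  case (Cons a P)
  obtain c k where a: "a = (c, k)" by (cases a)
  have "of_int c * F k = cst (of_int c) * F k" for c
    by (simp add: cst_of_int)
  moreover have "graded_by g n (cst d * F k)" for d
    using graded_by_mult[OF graded_by_cst_mon[of g "[]" 0 d], of n "F k" n] Cons.prems[of c k] a by simp
  ultimately show ?case using Cons by (auto simp: a intro: graded_by_add)
qed simp

lemma graded_Q_letter: "graded_by letter_grade (letter_grade x - (1, 0)) (Q_letter x)"
proof -
  have "word_grade w = letter_grade x - (1, 0)" if "(c, w) \<in> set (Q_terms x)" for c w
    using that by (cases x rule: letter_rank.cases) (auto simp: word_grade_def zero_prod_def)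
  then show ?thesis unfolding Q_letter_terms
    by (intro graded_int_comb graded_by_mon) (simp add: word_grade_def)
qed

lemma graded_Q_trace_word:
  "graded_by (\<lambda>t. word_grade (letters_of t)) (word_grade (letters_of t) - (1, 0)) (Q_trace_word t)"
  unfolding Q_trace_word_def
proof (rule graded_by_lin_ext)
  show "graded_by letter_grade (word_grade (letters_of t) - (1, 0)) (Q_word (letters_of t))"
    unfolding Q_word_def by (rule graded_by_der_word[OF graded_Q_letter]) (simp add: word_grade_def)
  show "graded_by (\<lambda>t. word_grade (letters_of t)) n (word_trace w)"
    if "sum_list (map letter_grade w) = n" for n w
    using that by (auto simp: word_trace_def Trace_word_inverse word_grade_def intro!: graded_by_mon)
qed

section \<open>The functional given by a table\<close>

text \<open>The value is nonzero only in degree zero, that is on words in \<open>phi\<close> and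
  \<open>phib\<close> alone, where \<open>canon_words\<close> identifies multi-traces without signs.
  Repeated keys in the table add up.\<close>

definition table_value :: "(letter list list \<times> int) list \<Rightarrow> content \<Rightarrow> letter list list \<Rightarrow> int" where
  "table_value K S ws = (if words_grade ws = (0, S)
     then let k = canon_words ws in \<Sum>(l, c)\<leftarrow>K. if l = k then c else 0 else 0)"

lemma canon_words_mset: "mset us = mset vs \<Longrightarrow> canon_words us = canon_words vs"
  unfolding canon_words_def sorted_list_of_multiset_mset[symmetric] by (simp only: mset_map)

lemma table_value_cong:
  "words_grade us = words_grade vs \<Longrightarrow> canon_words us = canon_words vs \<Longrightarrow> table_value K S us = table_value K S vs"
  by (simp add: table_value_def)

text \<open>In degree zero all words are bosonic, so the sign is trivial and sorting absorbs the
  exchange. In every other grade both sides vanish.\<close>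

lemma table_value_swap:
  "table_value K S (us @ x # y # vs) = (koszul (odd_word x) (odd_word y) * table_value K S (us @ y # x # vs) :: int)"
proof (cases "words_grade (us @ x # y # vs) = (0, S)")
  case True
  then have "fst (words_grade (us @ x # y # vs)) = 0" by simp
  then have "\<not> odd_word x" by (intro bosonic_not_odd bosonic_degree_0) (auto simp only: words_degree_0 set_append list.set)
  moreover have "canon_words (us @ x # y # vs) = canon_words (us @ y # x # vs)"
    by (rule canon_words_mset) simp
  ultimately show ?thesis
    by (auto simp: koszul_def algebra_simps intro: table_value_cong)
next
  case False
  then have "words_grade (us @ y # x # vs) \<noteq> (0, S)" by (simp add: algebra_simps)
  with False show ?thesis by (simp only: table_value_def if_False mult_zero_right)
qed

text \<open>Degree zero makes the rotated letter even, and the canonical form does not see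
  rotations. In every other grade both sides vanish.\<close>

lemma table_value_rotate1:
  "table_value K S (us @ (x # w) # vs) =
    (koszul (is_odd x) (odd_word w) * table_value K S (us @ (w @ [x]) # vs) :: int)"
proof (cases "words_grade (us @ (x # w) # vs) = (0, S)")
  case True
  then have "fst (words_grade (us @ (x # w) # vs)) = 0" by simp
  then have "fst (word_grade (x # w)) = 0" by (simp only: words_degree_0) simp
  then have "\<not> is_odd x" using bosonic_degree_0[of "x # w"] by simp
  moreover have "canon_words (us @ (x # w) # vs) = canon_words (us @ (w @ [x]) # vs)"
    using canon_rotate1[of "x # w"] by (simp add: canon_words_def)
  ultimately show ?thesis
    by (auto simp: koszul_def algebra_simps intro: table_value_cong)
next
  case False
  then have "words_grade (us @ (w @ [x]) # vs) \<noteq> (0, S)" by (simp add: algebra_simps)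
  with False show ?thesis by (simp only: table_value_def if_False mult_zero_right)
qed

lemma of_int_koszul: "of_int (koszul p q) = koszul p q"
  by (simp add: koszul_def)

lift_definition table_fun :: "(letter list list \<times> int) list \<Rightarrow> content \<Rightarrow> formal_op \<Rightarrow> complex"
  is "\<lambda>K S. lin_fun (\<lambda>ts. of_int (table_value K S (map letters_of ts)))"
proof -
  fix K S and f g :: "trace_word free_alg"
  let ?F = "\<lambda>ts. complex_of_int (table_value K S (map letters_of ts))"
  have swap: "?F (u @ x # y # v) = koszul (is_odd x) (is_odd y) * ?F (u @ y # x # v)" for u x y v
    by (simp only: map_append list.map of_int_mult of_int_koszul is_odd_trace_word_def
        table_value_swap[of K S "map letters_of u" "letters_of x" "letters_of y" "map letters_of v"])
  assume "f - g \<in> ideal_gen (supercomm_rels \<union> supercyclic_rels)"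
  then have "lin_fun ?F (f - g) = 0"
  proof (rule lin_fun_ideal[rotated])
    fix r u v assume "r \<in> supercomm_rels \<union> supercyclic_rels"
    then show "lin_fun ?F (mon u * r * mon v) = 0"
    proof
      assume "r \<in> supercomm_rels"
      then show ?thesis
        by (rule lin_fun_supercomm[rotated])
           (rule swap)
    next
      assume "r \<in> supercyclic_rels"
      then obtain x w where alt: "alternating (x # w)"
        and r: "r = word_trace (x # w) - koszul (is_odd x) (odd_word w) * word_trace (w @ [x])"
        by (auto simp: supercyclic_rels_def)
      have alt': "alternating (w @ [x])" using alt alternating_rotate1 by blast
      have "?F (u @ [Trace_word (x # w)] @ v) =
          koszul (is_odd x) (odd_word w) * ?F (u @ [Trace_word (w @ [x])] @ v)"
        using table_value_rotate1[of K S "map letters_of u" x w "map letters_of v"]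
        by (simp add: Trace_word_inverse alt alt' of_int_koszul)
      then show ?thesis
        unfolding r word_trace_def using alt alt' by (simp add: lin_fun_binomial)
    qed
  qed
  then show "lin_fun ?F f = lin_fun ?F g" by (simp add: lin_fun_diff)
qed

lemma tr_prod_eq_mon:
  assumes "list_all alternating ws"
  shows "tr_prod ws = abs_formal_op (mon (map Trace_word ws))"
proof -
  have "map letters_of (map Trace_word ws) = ws"
    using assms by (induction ws) (simp_all add: Trace_word_inverse)
  then show ?thesis using tr_prod_trace_words[of "map Trace_word ws"] by simp
qed

lemma table_fun_tr_prod:
  "list_all alternating ws \<Longrightarrow> table_fun K S (tr_prod ws) = of_int (table_value K S ws)"
proof -
  assume alt: "list_all alternating ws"
  then have "map (letters_of \<circ> Trace_word) ws = ws"
    by (induction ws) (simp_all add: Trace_word_inverse)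
  then show ?thesis by (simp add: tr_prod_eq_mon[OF alt] table_fun.abs_eq)
qed

lemma table_fun_add: "table_fun K S (x + y) = table_fun K S x + table_fun K S y"
  by transfer (rule lin_fun_add)

section \<open>The functional given by points\<close>

type_synonym mat2 = "int \<times> int \<times> int \<times> int"

fun mat2_mult :: "mat2 \<Rightarrow> mat2 \<Rightarrow> mat2" where
  "mat2_mult (a, b, c, d) (a', b', c', d') = (a * a' + b * c', a * b' + b * d', c * a' + d * c', c * b' + d * d')"

fun mat2_trace :: "mat2 \<Rightarrow> int" where
  "mat2_trace (a, b, c, d) = a + d"

definition word_mat2 :: "(letter \<Rightarrow> mat2) \<Rightarrow> letter list \<Rightarrow> mat2" where
  "word_mat2 pt w = foldr (\<lambda>x. mat2_mult (pt x)) w (1, 0, 0, 1)"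

text \<open>The integer weights allow differences of substitutions, as in
  \<open>points_3122\<close>.\<close>

definition point_value :: "(int \<times> (letter \<Rightarrow> mat2)) list \<Rightarrow> content \<Rightarrow> letter list list \<Rightarrow> int" where
  "point_value pts S ws = (if words_grade ws = (1, S)
     then \<Sum>(k, pt)\<leftarrow>pts. k * prod_list (map (\<lambda>w. mat2_trace (word_mat2 pt w)) ws) else 0)"

fun mat2_entry :: "mat2 \<Rightarrow> 2 \<Rightarrow> 2 \<Rightarrow> int" where
  "mat2_entry (a, b, c, d) i j = (if i = 1 then if j = 1 then a else b else if j = 1 then c else d)"

fun entry_value :: "(letter \<Rightarrow> mat2) \<Rightarrow> 2 entry \<Rightarrow> int" where
  "entry_value pt (Entry x i j) = mat2_entry (pt x) i j"

definition point_mon :: "(int \<times> (letter \<Rightarrow> mat2)) list \<Rightarrow> content \<Rightarrow> 2 entry list \<Rightarrow> int" where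
  "point_mon pts S es = (if sum_list (map entry_grade es) = (1, S)
     then \<Sum>(k, pt)\<leftarrow>pts. k * prod_list (map (entry_value pt) es) else 0)"

lemma entries_degree_nonneg: "0 \<le> fst (sum_list (map entry_grade es))"
proof (induction es)
  case (Cons e es)
  then show ?case by (cases e) (simp add: degree_nonneg)
qed simp

text \<open>A sign would need two odd entries, but these have total degree at least two, where the
  functional is zero. This is why commuting integers may be substituted for odd generators.\<close>

lemma point_mon_swap:
  "point_mon pts S (u @ x # y # v) = (koszul (is_odd x) (is_odd y) * point_mon pts S (u @ y # x # v) :: int)"
proof -
  have g: "sum_list (map entry_grade (u @ y # x # v)) = sum_list (map entry_grade (u @ x # y # v))"
    by (simp add: algebra_simps)
  have p: "prod_list (map (entry_value pt) (u @ y # x # v)) = prod_list (map (entry_value pt) (u @ x # y # v))" for pt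
    by (simp add: algebra_simps)
  have eq: "point_mon pts S (u @ y # x # v) = point_mon pts S (u @ x # y # v)"
    unfolding point_mon_def g p ..
  show ?thesis
  proof (cases "is_odd x \<and> is_odd y")
    case True
    obtain a i j b k l where xy: "x = Entry a i j" "y = Entry b k l" by (cases x, cases y)
    have "fst (sum_list (map entry_grade (u @ x # y # v))) \<ge> 2"
      using True entries_degree_nonneg[of u] entries_degree_nonneg[of v]
      by (simp add: xy degree_odd)
    then have "sum_list (map entry_grade (u @ x # y # v)) \<noteq> (1, S)"
      by (metis (no_types) fst_conv one_less_numeral_iff linorder_not_le semiring_norm(76))
    then show ?thesis unfolding eq by (simp add: point_mon_def)
  next
    case False
    then show ?thesis unfolding eq by (auto simp: koszul_def)
  qed
qed

lift_definition point_fun :: "(int \<times> (letter \<Rightarrow> mat2)) list \<Rightarrow> content \<Rightarrow> 2 entry gca \<Rightarrow> complex"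
  is "\<lambda>pts S. lin_fun (\<lambda>es. of_int (point_mon pts S es))"
proof -
  fix pts S and f g :: "2 entry free_alg"
  let ?F = "\<lambda>es. complex_of_int (point_mon pts S es)"
  have swap: "?F (u @ x # y # v) = koszul (is_odd x) (is_odd y) * ?F (u @ y # x # v)" for u x y v
    by (simp only: point_mon_swap[of pts S u x y v] of_int_mult of_int_koszul)
  assume "f - g \<in> ideal_gen supercomm_rels"
  then have "lin_fun ?F (f - g) = 0"
    by (rule lin_fun_ideal[rotated])
       (erule lin_fun_supercomm[rotated], rule swap)
  then show "lin_fun ?F f = lin_fun ?F g" by (simp add: lin_fun_diff)
qed

lemma point_fun_add: "point_fun pts S (x + y) = point_fun pts S x + point_fun pts S y"
  by transfer (rule lin_fun_add)

lemma mat2_entry_mult: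
  "mat2_entry (mat2_mult A B) i j = mat2_entry A i 1 * mat2_entry B 1 j + mat2_entry A i 2 * mat2_entry B 2 j"
  by (cases A; cases B) auto

section \<open>Evaluation of traces at integer matrices\<close>

abbreviation point_eval :: "(letter \<Rightarrow> mat2) \<Rightarrow> 2 entry free_alg \<Rightarrow> complex" where
  "point_eval pt \<equiv> lin_fun (\<lambda>es. of_int (prod_list (map (entry_value pt) es)))"

lemma point_eval_mult: "point_eval pt (f * g) = point_eval pt f * point_eval pt g"
  by (rule lin_fun_mult) simp

lemma point_eval_1: "point_eval pt 1 = 1"
  using lin_fun_mon[of "\<lambda>es. of_int (prod_list (map (entry_value pt) es))" "[]"] by (simp del: lin_fun_mon)

lemma point_eval_word_matrix:
  "point_eval pt (word_matrix w $ i $ j) = of_int (mat2_entry (word_mat2 pt w) i j)"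
proof (induction w arbitrary: i)
  case Nil
  show ?case using exhaust_2[of i] exhaust_2[of j]
    by (auto simp: word_mat2_def mat_def point_eval_1)
next
  case (Cons x w)
  have "point_eval pt (word_matrix (x # w) $ i $ j) =
      (\<Sum>k\<in>UNIV. of_int (mat2_entry (pt x) i k) * point_eval pt (word_matrix w $ k $ j))"
    by (simp add: matrix_matrix_mult_def generic_matrix_def lin_fun_sum point_eval_mult)
  then show ?case by (simp add: Cons sum_2 word_mat2_def mat2_entry_mult)
qed

lemma point_eval_trace_word:
  "point_eval pt (eval_trace_word t) = of_int (mat2_trace (word_mat2 pt (letters_of t)))"
proof -
  have "mat2_trace A = mat2_entry A 1 1 + mat2_entry A 2 2" for A by (cases A) simp
  then show ?thesis
    by (simp add: eval_trace_word_def trace_def lin_fun_add point_eval_word_matrix sum_2)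
qed

text \<open>Evaluation respects the grading, so the projection to grade \<open>(1, S)\<close> keeps
  or kills a whole product of traces. What remains is a weighted sum of ring homomorphisms.\<close>

lemma point_fun_ev_trace_words:
  "point_fun pts S (ev (abs_formal_op (mon ts))) = of_int (point_value pts S (map letters_of ts))"
proof -
  let ?f = "prod_list (map eval_trace_word ts) :: 2 entry free_alg"
  let ?n = "words_grade (map letters_of ts)"
  have l: "point_fun pts S (ev (abs_formal_op (mon ts))) = lin_fun (\<lambda>es. of_int (point_mon pts S es)) ?f"
    by (simp add: ev.abs_eq point_fun.abs_eq alg_hom_def)
  have gr: "graded_by entry_grade ?n ?f"
    using graded_by_prod_list[of ts entry_grade "\<lambda>t. word_grade (letters_of t)" eval_trace_word]
    by (simp add: graded_eval_trace_word words_grade_def comp_def)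
  have pe: "point_eval pt ?f = of_int (\<Prod>t\<leftarrow>ts. mat2_trace (word_mat2 pt (letters_of t)))" for pt
    by (induction ts) (simp_all add: point_eval_1 point_eval_mult point_eval_trace_word)
  show ?thesis
  proof (cases "?n = (1, S)")
    case True
    \<comment> \<open>The points are repackaged as weighted functionals on words, the shape that
      \<open>lin_fun_sum_weighted\<close> expects.\<close>
    let ?L = "map (\<lambda>(k, pt). (complex_of_int k, \<lambda>es. complex_of_int (prod_list (map (entry_value pt) es)))) pts"
    have L: "(\<Sum>(k, pt)\<leftarrow>pts. of_int k * of_int (prod_list (map (entry_value pt) es))) = (\<Sum>(k, G)\<leftarrow>?L. k * G es)" for es
      by (induction pts) auto
    have "lin_fun (\<lambda>es. of_int (point_mon pts S es)) ?f = lin_fun (\<lambda>es. \<Sum>(k, G)\<leftarrow>?L. k * G es) ?f"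
    proof (rule lin_fun_graded_cong[OF gr])
      fix es :: "2 entry list" assume "sum_list (map entry_grade es) = ?n"
      then have "point_mon pts S es = (\<Sum>(k, pt)\<leftarrow>pts. k * prod_list (map (entry_value pt) es))"
        by (simp add: point_mon_def True)
      then show "complex_of_int (point_mon pts S es) = (\<Sum>(k, G)\<leftarrow>?L. k * G es)"
        by (simp only: of_int_comb L)
    qed
    also have "\<dots> = (\<Sum>(k, G)\<leftarrow>?L. k * lin_fun G ?f)" by (rule lin_fun_sum_weighted)
    also have "\<dots> = (\<Sum>(k, pt)\<leftarrow>pts. of_int k * point_eval pt ?f)"
      by (induction pts) auto
    finally show ?thesis
      by (simp add: l pe point_value_def True of_int_comb comp_def)
  next
    case False
    then have "lin_fun (\<lambda>es. complex_of_int (point_mon pts S es)) ?f = 0"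
      by (intro lin_fun_graded_eq_0[OF gr]) (simp add: point_mon_def)
    then show ?thesis using False by (simp add: l point_value_def)
  qed
qed

section \<open>Multi-trace words with one fermion\<close>

text \<open>
  Representatives up to rotation and reordering of the words whose image under \<open>Q\<close> has eight letters:
  the fermion is moved to the very front, and all other traces start with an unbarred letter.
  The definition of \<open>even_words\<close> is meant for \<open>n \<in> {0, 2, 4}\<close> only.
\<close>

fun boson_words :: "bool \<Rightarrow> nat \<Rightarrow> letter list list" where
  "boson_words b 0 = [[]]"
| "boson_words b (Suc n) = concat (map (\<lambda>w.
     if b then [phib F1 # w, phib F2 # w] else [phi F1 # w, phi F2 # w]) (boson_words (\<not> b) n))"

definition even_words :: "nat \<Rightarrow> letter list list list" where
  "even_words n = (if n = 0 then [[]] else if n = 2 then map (\<lambda>u. [u]) (boson_words False 2)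
     else map (\<lambda>u. [u]) (boson_words False 4) @
       concat (map (\<lambda>u. map (\<lambda>v. [u, v]) (boson_words False 2)) (boson_words False 2)))"

text \<open>A fermion has content of size three, which leaves five bosons out of eight. Since its
  trace has even length, an odd number \<open>n\<close> of them shares that trace, and the other
  \<open>5 - n\<close> form purely bosonic traces.\<close>

definition one_fermion_words :: "letter list list list" where
  "one_fermion_words = concat (map (\<lambda>f. concat (map (\<lambda>n. concat (map (\<lambda>w.
     map ((#) (f # w)) (even_words (5 - n))) (boson_words (\<not> barred f) n))) [1, 3, 5]))
     [psi F1, psi F2, psib F1, psib F2])"

text \<open>Applied to degrees at two levels: it locates the trace containing the fermion and then
  the fermion within that trace.\<close>

lemma sum_list_eq_1_split:
  fixes g :: "'a \<Rightarrow> int"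
  assumes "\<And>x. 0 \<le> g x" and "sum_list (map g xs) = 1"
  shows "\<exists>u x v. xs = u @ x # v \<and> g x = 1 \<and> sum_list (map g (u @ v)) = 0"
  using assms(2)
proof (induction xs)
  case (Cons y xs)
  have s: "0 \<le> sum_list (map g xs)" by (induction xs) (simp_all add: assms(1))
  show ?case
  proof (cases "g y = 0")
    case True
    with Cons obtain u x v where "xs = u @ x # v" "g x = 1" "sum_list (map g (u @ v)) = 0" by auto
    with True have "y # xs = (y # u) @ x # v \<and> g x = 1 \<and> sum_list (map g ((y # u) @ v)) = 0" by simp
    then show ?thesis by blast
  next
    case False
    then have "g y \<ge> 1" using assms(1)[of y] by linarith
    with Cons.prems s have "g y = 1" "sum_list (map g xs) = 0" by simp_all
    then have "y # xs = [] @ y # xs \<and> g y = 1 \<and> sum_list (map g ([] @ xs)) = 0" by simp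
    then show ?thesis by blast
  qed
qed simp

lemma word_degree_1_split:
  assumes "fst (word_grade w) = 1"
  shows "\<exists>u f v. w = u @ f # v \<and> fst (letter_grade f) = 1 \<and> fst (word_grade (u @ v)) = 0"
  using sum_list_eq_1_split[of "\<lambda>x. fst (letter_grade x)" w] assms degree_nonneg
  by (simp add: word_grade_def fst_sum_list comp_def)

lemma words_degree_1_split:
  assumes "fst (words_grade ws) = 1"
  shows "\<exists>us w vs. ws = us @ w # vs \<and> fst (word_grade w) = 1 \<and> fst (words_grade (us @ vs)) = 0"
  using sum_list_eq_1_split[of "\<lambda>x. fst (word_grade x)" ws] assms word_degree_nonneg
  by (simp add: words_grade_def fst_sum_list comp_def)

lemma tr_prod_move:
  "list_all bosonic us \<Longrightarrow> tr_prod (us @ w # vs) = tr_prod (w # us @ vs)"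
proof (induction us)
  case (Cons u us)
  then have "\<not> odd_word u" by (simp add: bosonic_not_odd)
  then have "Tr u * Tr w = Tr w * Tr u" using Tr_comm[of u w] by (simp add: koszul_def)
  then have "Tr u * (Tr w * z) = Tr w * (Tr u * z)" for z by (simp only: mult.assoc[symmetric])
  with Cons show ?case by (simp add: tr_prod_Cons)
qed simp

section \<open>Letter counts and completeness of the enumeration\<close>

fun content_size :: "content \<Rightarrow> int" where
  "content_size (a, b, c, d) = a + b + c + d"

lemma content_size_add: "content_size (x + y) = content_size x + content_size y"
  by (cases x; cases y) simp

lemma content_size_bosonic: "fst (word_grade w) = 0 \<Longrightarrow> content_size (snd (word_grade w)) = int (length w)"
proof (induction w)
  case (Cons x w)
  then have "fst (letter_grade x) = 0" "fst (word_grade w) = 0" by (simp_all only: word_degree_0) simp_all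
  moreover from this(1) have "content_size (snd (letter_grade x)) = 1"
    by (cases x rule: letter_rank.cases) simp_all
  ultimately show ?case using Cons by (simp add: content_size_add)
qed (simp add: zero_prod_def)

lemma content_size_bosonic_words:
  "fst (words_grade ws) = 0 \<Longrightarrow> content_size (snd (words_grade ws)) = int (sum_list (map length ws))"
proof (induction ws)
  case (Cons w ws)
  then have "fst (word_grade w) = 0" "fst (words_grade ws) = 0" by (simp_all only: words_degree_0) simp_all
  with Cons show ?case by (simp add: content_size_add content_size_bosonic)
qed (simp add: zero_prod_def)

lemma successively_barred_last:
  "successively (\<lambda>x y. barred x \<noteq> barred y) (x # w) \<Longrightarrow> (barred (last (x # w)) = barred x) = even (length w)"
proof (induction w arbitrary: x)
  case (Cons y w)
  then have "barred x \<noteq> barred y" "(barred (last (y # w)) = barred y) = even (length w)"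
    by (simp_all only: successively.simps simp_thms)
  moreover have "last (x # y # w) = last (y # w)" by simp
  ultimately show ?case by (simp only: list.size even_Suc) auto
qed simp

lemma even_length_alternating: "alternating w \<Longrightarrow> even (length w)"
proof -
  assume a: "alternating w"
  then obtain x v where w: "w = x # v" by (cases w) (auto simp: alternating_def)
  show ?thesis
    using a successively_barred_last[of x "v @ [x]"] by (simp add: alternating_def w)
qed

lemma boson_words_complete:
  assumes "fst (word_grade w) = 0" "successively (\<lambda>x y. barred x \<noteq> barred y) w" "w \<noteq> [] \<Longrightarrow> barred (hd w) = b"
  shows "w \<in> set (boson_words b (length w))"
  using assms
proof (induction w arbitrary: b)
  case (Cons x w)
  have x: "fst (letter_grade x) = 0" and w: "fst (word_grade w) = 0"
    using Cons.prems(1) by (simp_all only: word_degree_0) simp_all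
  have "w \<in> set (boson_words (\<not> b) (length w))"
    using Cons.prems by (intro Cons.IH[OF w]) (auto simp: successively_Cons)
  moreover have "barred x = b" using Cons.prems(3) by simp
  then have "x \<in> set (if b then [phib F1, phib F2] else [phi F1, phi F2])"
    using x by (cases x rule: letter_rank.cases) auto
  ultimately show ?case by (cases b) auto
qed simp

lemma alternating_Cons:
  assumes "alternating (x # w)"
  shows "successively (\<lambda>x y. barred x \<noteq> barred y) w"
    and "w \<noteq> [] \<Longrightarrow> barred (hd w) \<longleftrightarrow> \<not> barred x"
proof -
  have "successively (\<lambda>x y. barred x \<noteq> barred y) (x # w)"
    using assms unfolding alternating_def successively_append_iff by blast
  then show "successively (\<lambda>x y. barred x \<noteq> barred y) w"
    and "w \<noteq> [] \<Longrightarrow> barred (hd w) \<longleftrightarrow> \<not> barred x"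
    by (cases w; simp)+
qed

text \<open>An alternating word has positive even length, so four letters leave room for at most two
  traces.\<close>

lemma even_words_complete:
  assumes "list_all alternating ws" "fst (words_grade ws) = 0" "list_all (\<lambda>w. \<not> barred (hd w)) ws"
    and "sum_list (map length ws) = n" "n \<in> {0, 2, 4}"
  shows "ws \<in> set (even_words n)"
proof -
  have len: "length w \<ge> 2 \<and> even (length w)" if "w \<in> set ws" for w
  proof -
    have "alternating w" using that assms(1) by (simp add: list_all_iff)
    then have "even (length w)" "length w \<noteq> 0" by (auto simp: even_length_alternating alternating_def)
    then show ?thesis by presburger
  qed
  have mem: "w \<in> set (boson_words False (length w))" if "w \<in> set ws" for w
  proof (rule boson_words_complete)
    show "fst (word_grade w) = 0" using that assms(2) by (simp add: words_degree_0)
    show "successively (\<lambda>x y. barred x \<noteq> barred y) w"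
      using that assms(1) by (auto simp: list_all_iff alternating_def successively_append_iff)
    show "barred (hd w) = False" using that assms(3) by (simp add: list_all_iff)
  qed
  consider "ws = []" | u where "ws = [u]" | u v where "ws = [u, v]" | u v w vs where "ws = u # v # w # vs"
    by (metis neq_Nil_conv)
  then show ?thesis
  proof cases
    case (2 u)
    with mem[of u] len[of u] assms(4,5) show ?thesis by (auto simp: even_words_def)
  next
    case (3 u v)
    with len[of u] len[of v] assms(4,5) have "length u = 2" "length v = 2" "n = 4" by auto
    with 3 mem[of u] mem[of v] show ?thesis by (auto simp: even_words_def)
  next
    case (4 u v w vs)
    with len[of u] len[of v] len[of w] assms(4,5) show ?thesis by auto
  qed (use assms(4) in \<open>auto simp: even_words_def\<close>)
qed

definition unbarred_first :: "letter list \<Rightarrow> letter list" where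
  "unbarred_first w = (if barred (hd w) then rotate1 w else w)"

lemma unbarred_first:
  assumes "alternating w"
  shows "alternating (unbarred_first w)" "\<not> barred (hd (unbarred_first w))"
    "word_grade (unbarred_first w) = word_grade w" "length (unbarred_first w) = length w"
proof -
  obtain x v where w: "w = x # v" using assms by (cases w) (auto simp: alternating_def)
  show "alternating (unbarred_first w)"
    using assms alternating_rotate1[of x v] by (simp add: unbarred_first_def w)
  show "\<not> barred (hd (unbarred_first w))"
    using assms by (cases v) (auto simp: unbarred_first_def w alternating_def)
  show "word_grade (unbarred_first w) = word_grade w" "length (unbarred_first w) = length w"
    by (simp_all add: unbarred_first_def w add.commute)
qed

lemma one_fermion_wordsI:
  assumes "f \<in> set [psi F1, psi F2, psib F1, psib F2]" "n \<in> set [1, 3, 5]"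
    "w \<in> set (boson_words (\<not> barred f) n)" "ws \<in> set (even_words (5 - n))"
  shows "(f # w) # ws \<in> set one_fermion_words"
  using assms unfolding one_fermion_words_def set_concat set_map image_image by blast

text \<open>The single fermion never passes another odd letter, so rotating traces and permuting
  them costs no sign. The content then bounds the number of bosons and leaves only the listed
  shapes.\<close>

lemma one_fermion_normal_form:
  assumes alt: "list_all alternating ws" and gr: "words_grade ws = (1, S)" and S: "content_size S = 8"
  shows "\<exists>ws'\<in>set one_fermion_words.
    tr_prod ws = tr_prod ws' \<and> list_all alternating ws' \<and> words_grade ws' = (1, S)"
proof -
  obtain us w vs where ws: "ws = us @ w # vs" and w1: "fst (word_grade w) = 1"
    and rest0: "fst (words_grade (us @ vs)) = 0"
    using words_degree_1_split[of ws] gr by auto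
  obtain u f v where w: "w = u @ f # v" and f1: "fst (letter_grade f) = 1"
    and uv0: "fst (word_grade (u @ v)) = 0"
    using word_degree_1_split[OF w1] by blast
  define rest where "rest = map unbarred_first (us @ vs)"
  have altr: "alternating x" if "x \<in> set (us @ vs)" for x
    using alt that by (auto simp: ws list_all_iff)
  have alt_rest: "list_all alternating rest" "list_all (\<lambda>w. \<not> barred (hd w)) rest"
    using unbarred_first(1,2)[OF altr] by (auto simp: rest_def list_all_iff)
  have "words_grade (map unbarred_first xs) = words_grade xs" if "\<forall>x\<in>set xs. alternating x" for xs
    using that by (induction xs) (simp_all add: unbarred_first)
  from this[of "us @ vs"] altr have gr_rest: "words_grade rest = words_grade (us @ vs)"
    by (simp add: rest_def del: map_append)
  have bos: "list_all bosonic (us @ vs)"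
    using rest0 bosonic_degree_0 unfolding words_degree_0 list_all_iff[of bosonic] by blast
  have "bosonic x \<Longrightarrow> Tr (unbarred_first x) = Tr x" for x
    using Tr_rotate[of x 1] by (simp add: unbarred_first_def)
  then have "tr_prod (map unbarred_first xs) = tr_prod xs" if "list_all bosonic xs" for xs
    using that by (induction xs) (simp_all add: tr_prod_Cons)
  from this[OF bos] have tr_rest: "tr_prod rest = tr_prod (us @ vs)" by (simp add: rest_def)
  have "bosonic u" using uv0 bosonic_degree_0[of "u @ v"] by simp
  then have Tr_w: "Tr w = Tr ((f # v) @ u)"
    unfolding w Tr_append[of u] by (simp add: koszul_def bosonic_not_odd)
  let ?w = "(f # v) @ u"
  have alt_w: "alternating ?w"
    using alt alternating_rotate[of u "f # v"] by (simp add: ws w)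
  have "words_grade (?w # rest) = words_grade ws"
    by (simp add: gr_rest ws w algebra_simps)
  then have gr': "words_grade (?w # rest) = (1, S)" by (simp add: gr)
  have "tr_prod ws = tr_prod (w # us @ vs)"
    unfolding ws using bos by (intro tr_prod_move) simp
  then have tr: "tr_prod ws = tr_prod (?w # rest)"
    by (simp only: tr_prod_Cons tr_rest Tr_w)
  have f: "f \<in> set [psi F1, psi F2, psib F1, psib F2]"
    using f1 by (cases f rule: letter_rank.cases) auto
  have vu0: "fst (word_grade (v @ u)) = 0" using uv0 by (simp add: add.commute)
  have rest0': "fst (words_grade rest) = 0" using rest0 by (simp only: gr_rest)
  \<comment> \<open>The fermion counts as the three bosons that \<open>Q\<close> turns it into, and
    every other letter counts once.\<close>
  have "content_size (snd (letter_grade f)) = 3" using f by auto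
  then have "content_size (snd (words_grade (?w # rest))) =
      3 + int (length (v @ u)) + int (sum_list (map length rest))"
    using content_size_bosonic[OF vu0] content_size_bosonic_words[OF rest0']
    by (simp add: content_size_add)
  then have len: "length (v @ u) + sum_list (map length rest) = 5"
    using S unfolding gr' by simp
  \<comment> \<open>The whole trace has even length, and the fermion accounts for one of its
    letters.\<close>
  have "odd (length (v @ u))" using even_length_alternating[OF alt_w] by simp
  moreover have "k \<in> {1, 3, 5}" if "odd k" "k \<le> 5" for k :: nat
    unfolding insert_iff empty_iff using that by presburger
  ultimately have n: "length (v @ u) \<in> {1, 3, 5}" using len by (metis le_add1)
  have "v @ u \<in> set (boson_words (\<not> barred f) (length (v @ u)))"
    using alternating_Cons[of f "v @ u"] alt_w by (intro boson_words_complete[OF vu0]) auto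
  moreover have "rest \<in> set (even_words (5 - length (v @ u)))"
    using n len by (intro even_words_complete alt_rest rest0') auto
  ultimately have "?w # rest \<in> set one_fermion_words"
    using one_fermion_wordsI[OF f, of "length (v @ u)"] n by simp
  with tr alt_w alt_rest(1) gr' show ?thesis by auto
qed

section \<open>Certificates\<close>

text \<open>The enumeration covers all contents of size eight, and the premise on the grade selects
  those of content \<open>S\<close>. For the remaining grades both functionals vanish by
  definition.\<close>

definition certificate :: "(letter list list \<times> int) list \<Rightarrow> (int \<times> (letter \<Rightarrow> mat2)) list \<Rightarrow> content \<Rightarrow> bool" where
  "certificate K pts S \<longleftrightarrow> list_all (\<lambda>ws. words_grade ws = (1, S) \<longrightarrow>
     (\<Sum>(c, us)\<leftarrow>Q_expands ws. c * table_value K S us) = point_value pts S ws) one_fermion_words"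

text \<open>Alternation is a condition on the whole cyclic word and not on a suffix, so the
  induction carries the letters already passed in the prefix \<open>s\<close>.\<close>

lemma alternating_Q_expand:
  "alternating (s @ w) \<Longrightarrow> (c, u) \<in> set (Q_expand w) \<Longrightarrow> alternating (s @ u)"
proof (induction w arbitrary: s c u)
  case (Cons x w)
  have t: "\<exists>y1 y2 y3. v = [y1, y2, y3] \<and> barred y1 = barred x \<and> barred y2 \<noteq> barred x \<and> barred y3 = barred x"
    if "(d, v) \<in> set (Q_terms x)" for d v
    using that by (cases x) auto
  from Cons.prems(2) consider d v where "(d, v) \<in> set (Q_terms x)" "u = v @ w"
    | d v where "(d, v) \<in> set (Q_expand w)" "u = x # v" by auto
  then show ?case
  proof cases
    case (1 d v)
    from t[OF 1(1)] 1(2) alternating_expand[OF Cons.prems(1)] show ?thesis by fastforce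
  next
    case (2 d v)
    with Cons.IH[of "s @ [x]" d v] Cons.prems(1) show ?thesis by simp
  qed
qed simp

lemma alternating_Q_expands:
  "list_all alternating ws \<Longrightarrow> (c, us) \<in> set (Q_expands ws) \<Longrightarrow> list_all alternating us"
proof (induction ws arbitrary: c us)
  case (Cons w ws)
  then show ?case using alternating_Q_expand[of "[]" w] by fastforce
qed simp

lemma point_fun_ev_tr_prod:
  "list_all alternating ws \<Longrightarrow> point_fun pts S (ev (tr_prod ws)) = of_int (point_value pts S ws)"
proof -
  assume alt: "list_all alternating ws"
  then have "map letters_of (map Trace_word ws) = ws"
    by (induction ws) (simp_all add: Trace_word_inverse)
  then show ?thesis
    by (simp add: tr_prod_eq_mon[OF alt] point_fun_ev_trace_words del: map_map)
qed

text \<open>Both sides depend only on the formal operator, so the word may be replaced by its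
  enumerated representative, for which the identity has been checked.\<close>

lemma certificate_tr_prod:
  assumes cert: "certificate K pts S" and S: "content_size S = 8" and alt: "list_all alternating ws"
    and gr: "words_grade ws = (1, S)"
  shows "point_fun pts S (ev (tr_prod ws)) = table_fun K S (Q_formal (tr_prod ws))"
proof -
  obtain ws' where ws': "ws' \<in> set one_fermion_words" "tr_prod ws = tr_prod ws'"
    "list_all alternating ws'" "words_grade ws' = (1, S)"
    using one_fermion_normal_form[OF alt gr S] by blast
  have "table_fun K S (Q_formal (tr_prod ws')) = int_comb (\<lambda>us. table_fun K S (tr_prod us)) (Q_expands ws')"
    unfolding Q_formal_tr_prod[OF ws'(3)] by (rule additive_int_comb) (rule table_fun_add)
  also have "\<dots> = int_comb (\<lambda>us. of_int (table_value K S us)) (Q_expands ws')"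
    using alternating_Q_expands[OF ws'(3)] by (intro int_comb_cong table_fun_tr_prod) blast
  also have "\<dots> = of_int (\<Sum>(c, us)\<leftarrow>Q_expands ws'. c * table_value K S us)"
    by (simp add: int_comb_def of_int_comb)
  also have "\<dots> = of_int (point_value pts S ws')"
    using cert ws'(1,4) by (simp add: certificate_def list_all_iff)
  finally show ?thesis by (simp add: ws'(2) point_fun_ev_tr_prod[OF ws'(3)])
qed

lemma certificate_sound:
  assumes cert: "certificate K pts S" and S: "content_size S = 8"
  shows "point_fun pts S (ev x) = table_fun K S (Q_formal x)"
proof -
  obtain f where x: "x = abs_formal_op f"
    using formal_op.abs_induct[of "\<lambda>z. \<exists>f. z = abs_formal_op f" x] by blast
  let ?P = "\<lambda>es. complex_of_int (point_mon pts S es)"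
  let ?T = "\<lambda>ts. complex_of_int (table_value K S (map letters_of ts))"
  have P: "point_fun pts S (ev (abs_formal_op f)) = lin_fun ?P (alg_hom eval_trace_word f)" for f
    by (simp add: ev.abs_eq point_fun.abs_eq)
  have T: "table_fun K S (Q_formal (abs_formal_op f)) = lin_fun ?T (odd_der Q_trace_word f)" for f
    by (simp add: Q_formal.abs_eq table_fun.abs_eq)
  have base: "lin_fun ?P (alg_hom eval_trace_word (mon ts)) = lin_fun ?T (odd_der Q_trace_word (mon ts))" for ts
  proof (cases "words_grade (map letters_of ts) = (1, S)")
    case True
    have "list_all alternating (map letters_of ts)" using letters_of by (auto simp: list_all_iff)
    from certificate_tr_prod[OF cert S this True] show ?thesis
      by (simp only: tr_prod_trace_words P T)
  next
    case False
    have "lin_fun ?P (alg_hom eval_trace_word (mon ts)) = 0"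
      using False by (simp only: P[symmetric] point_fun_ev_trace_words) (simp add: point_value_def)
    \<comment> \<open>\<open>Q\<close> lowers the degree by one and keeps the content, so a result
      of grade \<open>(0, S)\<close> can only come from grade \<open>(1, S)\<close>.\<close>
    moreover have "lin_fun ?T (odd_der Q_trace_word (mon ts)) = 0"
    proof (rule lin_fun_graded_eq_0)
      show "graded_by (\<lambda>t. word_grade (letters_of t)) (words_grade (map letters_of ts) - (1, 0))
          (odd_der Q_trace_word (mon ts))"
        unfolding odd_der_def lin_ext_mon
        by (rule graded_by_der_word[OF graded_Q_trace_word]) (simp add: words_grade_def comp_def)
      fix vs assume "sum_list (map (\<lambda>t. word_grade (letters_of t)) vs) = words_grade (map letters_of ts) - (1, 0)"
      then have "words_grade (map letters_of vs) + (1, 0) = words_grade (map letters_of ts)"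
        by (simp add: words_grade_def comp_def)
      with False have "words_grade (map letters_of vs) \<noteq> (0, S)" by (metis add_0 add.right_neutral add_Pair)
      then show "?T vs = 0" by (simp add: table_value_def)
    qed
    ultimately show ?thesis by simp
  qed
  have "lin_fun ?P (alg_hom eval_trace_word f) = lin_fun ?T (odd_der Q_trace_word f)"
  proof (induction f rule: free_alg_induct)
    case (mon c w)
    show ?case using base[of w]
      by (simp add: alg_hom_def odd_der_def lin_ext_scale lin_fun_scale)
  qed (simp add: alg_hom_def odd_der_def lin_ext_add lin_fun_add)
  then show ?thesis by (simp only: x P T)
qed

text \<open>An exact operator is the evaluation of some formal \<open>Q z\<close> because
  \<open>Q\<close> commutes with \<open>ev\<close>, and \<open>Q z\<close> is closed by
  nilpotency.\<close>

lemma monotone_exact_closed: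
  assumes "y \<in> monotone_ops + exact_ops"
  shows "\<exists>x. y = ev x \<and> Q_formal x = 0"
proof -
  obtain p q where y: "y = p + q" and p: "p \<in> monotone_ops" and q: "q \<in> exact_ops"
    using assms by (rule set_plus_elim)
  obtain x where x: "p = ev x" "Q_formal x = 0" using p unfolding monotone_ops_def by blast
  obtain z where z: "q = Q_matrix (ev z)" using q unfolding exact_ops_def trace_algebra_def by blast
  have "y = ev (x + Q_formal z)" unfolding y x(1) z Q_matrix_ev ev_add ..
  moreover have "Q_formal (x + Q_formal z) = 0"
    unfolding Q_formal_add x(2) Q_formal_nilpotent by simp
  ultimately show ?thesis by blast
qed

lemma certificate_not_monotone_exact:
  assumes "certificate K pts S" "content_size S = 8" "list_all (\<lambda>(c, ws). list_all alternating ws) P"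
    and "(\<Sum>(c, ws)\<leftarrow>P. c * point_value pts S ws) \<noteq> 0"
  shows "(ev (int_comb tr_prod P) :: 2 entry gca) \<notin> monotone_ops + exact_ops"
proof
  assume "(ev (int_comb tr_prod P) :: 2 entry gca) \<in> monotone_ops + exact_ops"
  from monotone_exact_closed[OF this] obtain x
    where x: "ev (int_comb tr_prod P) = (ev x :: 2 entry gca)" "Q_formal x = 0"
    by (elim exE conjE)
  have "table_fun K S 0 = 0" using table_fun_add[of K S 0 0] by simp
  then have "point_fun pts S (ev (int_comb tr_prod P)) = 0"
    by (simp only: x certificate_sound[OF assms(1,2)])
  moreover have "point_fun pts S (ev (int_comb tr_prod P)) = int_comb (\<lambda>ws. point_fun pts S (ev (tr_prod ws))) P"
    by (rule additive_int_comb[where h = "\<lambda>x. point_fun pts S (ev x)"]) (simp add: ev_add point_fun_add)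
  moreover have "\<dots> = int_comb (\<lambda>ws. of_int (point_value pts S ws)) P"
    by (rule int_comb_cong) (use assms(3) in \<open>auto simp: list_all_iff intro!: point_fun_ev_tr_prod\<close>)
  moreover have "\<dots> = of_int (\<Sum>(c, ws)\<leftarrow>P. c * point_value pts S ws)"
    by (simp add: int_comb_def of_int_comb)
  ultimately show False using assms(4) by (metis of_int_eq_0_iff)
qed

section \<open>The dressed operators\<close>

definition dressing :: "flavour \<Rightarrow> flavour \<Rightarrow> flavour \<Rightarrow> flavour \<Rightarrow> trace_poly" where
  "dressing a b c d = (let t = [phib c, phi d] in
    [(4, [[psib F1, phi F2, phib a, phi b], t]), (-4, [[psib F2, phi F1, phib a, phi b], t]),
     (-3, [[psib F1, phi F2], [phib a, phi b], t]), (3, [[psib F2, phi F1], [phib a, phi b], t]),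
     (-4, [[psi F1, phib F2, phi b, phib a], t]), (4, [[psi F2, phib F1, phi b, phib a], t]),
     (3, [[psi F1, phib F2], [phi b, phib a], t]), (-3, [[psi F2, phib F1], [phi b, phib a], t])])"

definition eps_pairs :: "(int \<times> flavour \<times> flavour) list" where
  "eps_pairs = [(1, F1, F2), (-1, F2, F1)]"

definition lower_dressing :: "flavour \<Rightarrow> flavour \<Rightarrow> trace_poly" where
  "lower_dressing b d = int_bind eps_pairs (\<lambda>(a, c). dressing a b c d @ dressing a d c b)"

definition upper_dressing :: "flavour \<Rightarrow> flavour \<Rightarrow> trace_poly" where
  "upper_dressing a c = int_bind eps_pairs (\<lambda>(b, d). dressing a b c d @ dressing c b a d)"

text \<open>The indices of the bosonic barred letters and of the bosonic unbarred letters are each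
  contracted antisymmetrically, leaving \<open>b\<close> and \<open>d\<close> free. The second
  relation reverses each two-letter block, which pairs neighbours differently in the longer
  traces.\<close>

definition lower_relation :: "flavour \<Rightarrow> flavour \<Rightarrow> trace_poly" where
  "lower_relation b d = int_bind eps_pairs (\<lambda>(a, c). int_bind eps_pairs (\<lambda>(k, l).
     trace_relation [psib b, phi d] [phib a, phi k] [phib c, phi l] @
     trace_relation [phi d, psib b] [phi k, phib a] [phi l, phib c]))"

definition upper_relation :: "flavour \<Rightarrow> flavour \<Rightarrow> trace_poly" where
  "upper_relation a c = int_bind eps_pairs (\<lambda>(b, d). int_bind eps_pairs (\<lambda>(k, l).
     trace_relation [psi a, phib c] [phi b, phib k] [phi d, phib l] @
     trace_relation [phib c, psi a] [phib k, phi b] [phib l, phi d]))"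

text \<open>The added terms are symmetrised in the free indices, like the dressing, and evaluate to
  zero. With the coefficient -6 here, and 6 in \<open>upper_closed\<close>, the image under
  \<open>Q\<close> cancels formally.\<close>

definition lower_closed :: "flavour \<Rightarrow> flavour \<Rightarrow> trace_poly" where
  "lower_closed b d = lower_dressing b d @ int_scale (-6) (lower_relation b d @ lower_relation d b)"

definition upper_closed :: "flavour \<Rightarrow> flavour \<Rightarrow> trace_poly" where
  "upper_closed a c = upper_dressing a c @ int_scale 6 (upper_relation a c @ upper_relation c a)"

definition singlet :: trace_poly where
  "singlet = int_bind eps_pairs (\<lambda>(a, c). int_bind eps_pairs (\<lambda>(b, d). dressing a b c d))"

definition bitriplet :: "flavour \<Rightarrow> flavour \<Rightarrow> flavour \<Rightarrow> flavour \<Rightarrow> trace_poly" where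
  "bitriplet a b c d = dressing a b c d @ dressing c b a d @ dressing a d c b @ dressing c d a b"

section \<open>Evaluation of the dressed operators and of the relations\<close>

lemma ev_int_comb: "ev (int_comb F P) = int_comb (\<lambda>k. ev (F k)) P"
  by (rule additive_int_comb) (rule ev_add)

abbreviation ev_poly :: "trace_poly \<Rightarrow> 2 entry gca" where
  "ev_poly P \<equiv> ev (int_comb tr_prod P)"

lemma ev_poly_bind: "ev_poly (int_bind P g) = int_comb (\<lambda>k. ev_poly (g k)) P"
  unfolding int_comb_bind by (rule ev_int_comb)

lemma ev_poly_append: "ev_poly (P @ P') = ev_poly P + ev_poly P'"
  by (simp add: ev_add)

lemma ev_poly_scale: "ev_poly (int_scale c P) = of_int c * ev_poly P"
  unfolding int_comb_scale by (rule additive_of_int_mult[OF ev_add])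

lemma eps_sum: "(\<Sum>a\<in>UNIV. \<Sum>b\<in>UNIV. eps a b * F a b) = int_comb (\<lambda>(a, b). F a b) eps_pairs"
  by (simp add: UNIV_flavour eps_def eps_pairs_def)

lemma ev_dressing: "ev_poly (dressing a b c d) = O_op a b * T_op c d"
  unfolding O_op_def T_op_def ev_mult[symmetric]
  by (simp add: dressing_def Let_def tr_prod_Cons UNIV_flavour eps_def algebra_simps)

lemma ev_lower_dressing:
  "ev_poly (lower_dressing b d) = (\<Sum>a\<in>UNIV. \<Sum>c\<in>UNIV. eps a c * (O_op a b * T_op c d + O_op a d * T_op c b))"
  unfolding eps_sum lower_dressing_def ev_poly_bind
  by (simp only: case_prod_unfold ev_poly_append ev_dressing)

lemma ev_upper_dressing:
  "ev_poly (upper_dressing a c) = (\<Sum>b\<in>UNIV. \<Sum>d\<in>UNIV. eps b d * (O_op a b * T_op c d + O_op c b * T_op a d))"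
  unfolding eps_sum upper_dressing_def ev_poly_bind
  by (simp only: case_prod_unfold ev_poly_append ev_dressing)

lemma ev_singlet:
  "ev_poly singlet = (\<Sum>a\<in>UNIV. \<Sum>c\<in>UNIV. \<Sum>b\<in>UNIV. \<Sum>d\<in>UNIV. eps a c * eps b d * (O_op a b * T_op c d))"
proof -
  have "ev_poly singlet = (\<Sum>a\<in>UNIV. \<Sum>c\<in>UNIV. eps a c * (\<Sum>b\<in>UNIV. \<Sum>d\<in>UNIV. eps b d * (O_op a b * T_op c d)))"
    unfolding eps_sum singlet_def ev_poly_bind
    by (simp only: case_prod_unfold ev_poly_bind ev_dressing)
  then show ?thesis by (simp only: sum_distrib_left mult.assoc)
qed

lemma ev_bitriplet:
  "ev_poly (bitriplet a b c d) =
    O_op a b * T_op c d + O_op c b * T_op a d + O_op a d * T_op c b + O_op c d * T_op a b"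
  by (simp only: bitriplet_def ev_poly_append ev_dressing add.assoc)

lemma ev_lower_relation: "ev_poly (lower_relation b d) = 0"
proof -
  have "ev_poly (trace_relation [psib b, phi d] [phib a, phi k] [phib c, phi l]) = 0"
    and "ev_poly (trace_relation [phi d, psib b] [phi k, phib a] [phi l, phib c]) = 0" for a c k l
    by (rule ev_trace_relation; simp add: trace_relation_def alternating_def)+
  then show ?thesis
    by (simp only: lower_relation_def ev_poly_bind case_prod_unfold ev_poly_append) (simp add: eps_pairs_def)
qed

lemma ev_upper_relation: "ev_poly (upper_relation a c) = 0"
proof -
  have "ev_poly (trace_relation [psi a, phib c] [phi b, phib k] [phi d, phib l]) = 0"
    and "ev_poly (trace_relation [phib c, psi a] [phib k, phi b] [phib l, phi d]) = 0" for b d k l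
    by (rule ev_trace_relation; simp add: trace_relation_def alternating_def)+
  then show ?thesis
    by (simp only: upper_relation_def ev_poly_bind case_prod_unfold ev_poly_append) (simp add: eps_pairs_def)
qed

text \<open>The hypotheses of \<open>Q_formal_eq_0\<close> in executable form, with the expansion
  under \<open>Q\<close> shared between the two tests.\<close>

definition closed_poly :: "trace_poly \<Rightarrow> bool" where
  "closed_poly P \<longleftrightarrow> list_all (\<lambda>(c, ws). list_all alternating ws) P \<and>
     (let R = int_bind P Q_expands in
       list_all (\<lambda>(c, ws). list_all bosonic ws) R \<and> collect_terms (map (apsnd canon_words) R) = [])"

lemma closed_poly_monotone: "closed_poly P \<Longrightarrow> ev_poly P \<in> monotone_ops + exact_ops"
proof -
  assume "closed_poly P"
  then have "Q_formal (int_comb tr_prod P) = 0"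
    by (intro Q_formal_eq_0) (simp_all add: closed_poly_def Let_def)
  then have "ev_poly P \<in> monotone_ops" unfolding monotone_ops_def by blast
  moreover have "Q_matrix 0 = (0 :: 2 entry gca)" by transfer (simp add: odd_der_def ideal_gen.zero)
  moreover have "ev 0 = (0 :: 2 entry gca)" using ev_add[of 0 0, where 'a = 2] by simp
  ultimately have "ev_poly P + 0 \<in> monotone_ops + exact_ops"
    unfolding exact_ops_def trace_algebra_def by (intro set_plus_intro) (auto intro!: image_eqI[of 0 _ 0])
  then show ?thesis by simp
qed

lemma closed_lower: "closed_poly (lower_closed b d)"
proof -
  have "closed_poly (lower_closed F1 F1)" by code_simp
  moreover have "closed_poly (lower_closed F1 F2)" by code_simp
  moreover have "closed_poly (lower_closed F2 F1)" by code_simp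
  moreover have "closed_poly (lower_closed F2 F2)" by code_simp
  ultimately show ?thesis by (cases b; cases d) simp_all
qed

lemma closed_upper: "closed_poly (upper_closed a c)"
proof -
  have "closed_poly (upper_closed F1 F1)" by code_simp
  moreover have "closed_poly (upper_closed F1 F2)" by code_simp
  moreover have "closed_poly (upper_closed F2 F1)" by code_simp
  moreover have "closed_poly (upper_closed F2 F2)" by code_simp
  ultimately show ?thesis by (cases a; cases c) simp_all
qed

lemma lower_dressing_disallowed: "ev_poly (lower_dressing b d) \<in> monotone_ops + exact_ops"
  using closed_poly_monotone[OF closed_lower[of b d]]
  unfolding lower_closed_def ev_poly_append ev_poly_scale ev_lower_relation by simp

lemma upper_dressing_disallowed: "ev_poly (upper_dressing a c) \<in> monotone_ops + exact_ops"
  using closed_poly_monotone[OF closed_upper[of a c]]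
  unfolding upper_closed_def ev_poly_append ev_poly_scale ev_upper_relation by simp

section \<open>Certificates for the allowed dressings\<close>

text \<open>Tables may thus list any representative of a multi-trace, since the keys are brought to
  the form that \<open>table_value\<close> compares.\<close>

definition key_table :: "trace_poly \<Rightarrow> (letter list list \<times> int) list" where
  "key_table = map (\<lambda>(c, ws). (canon_words ws, c))"

text \<open>Reading off the first term suffices, as all terms of a table below have the same
  content.\<close>

definition content_of :: "trace_poly \<Rightarrow> content" where
  "content_of P = snd (words_grade (snd (hd P)))"

fun other :: "flavour \<Rightarrow> flavour" where "other F1 = F2" | "other F2 = F1"

fun flavour_sign :: "flavour \<Rightarrow> int" where "flavour_sign F1 = 1" | "flavour_sign F2 = -1"

text \<open>The zero matrices for \<open>Dphi\<close> and \<open>Dphib\<close> are default values: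
  these letters have degree two and cannot occur in a word of degree one.\<close>

fun point :: "flavour \<Rightarrow> flavour \<Rightarrow> mat2 list \<Rightarrow> letter \<Rightarrow> mat2" where
  "point i j ms (phi a) = (if a = i then ms ! 0 else ms ! 1)"
| "point i j ms (phib a) = (if a = j then ms ! 2 else ms ! 3)"
| "point i j ms (psi a) = mat2_mult (flavour_sign i, 0, 0, flavour_sign i) (if a = j then ms ! 4 else ms ! 5)"
| "point i j ms (psib a) = mat2_mult (flavour_sign j, 0, 0, flavour_sign j) (if a = i then ms ! 6 else ms ! 7)"
| "point i j ms (Dphi a) = (0, 0, 0, 0)"
| "point i j ms (Dphib a) = (0, 0, 0, 0)"

text \<open>
  The certificates were found by linear algebra over the integers. A name like \<open>table_3122\<close> lists
  how often \<open>phi i\<close>, \<open>phi (other i)\<close>, \<open>phib j\<close> and \<open>phib (other j)\<close> occur; the matrices of a point are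
  those for \<open>phi\<close>, \<open>phib\<close>, \<open>psi\<close> and \<open>psib\<close>, each for the two flavours. Exchanging the flavours of \<open>phi\<close>
  commutes with \<open>Q\<close> if \<open>psi\<close> changes sign, whence the signs in \<open>point\<close>.

  The contents 3122 and 2231 arise from 3131 by composing with a raising operator of one of the two
  \<open>SL(2)\<close> flavour symmetries; on points it becomes a difference of two substitutions.
\<close>

definition table_3131 :: "flavour \<Rightarrow> flavour \<Rightarrow> trace_poly" where
  "table_3131 i j = (let p = phi i; p' = phi (other i); q = phib j; q' = phib (other j) in
    [(1, [[p, q], [p, q, p, q', p', q]]),
     (1, [[p, q, p, q, p, q', p', q]])])"

definition points_3131 :: "flavour \<Rightarrow> flavour \<Rightarrow> (int \<times> (letter \<Rightarrow> mat2)) list" where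
  "points_3131 i j =
    [(1, point i j [(0, 1, -1, 1), (0, -1, 0, 0), (1, 0, 0, 1), (-1, 0, 0, 0), (0, -1, 0, 0), (0, -1, 0, 0), (1, 0, 0, 0), (1, 0, 0, 0)])]"

definition table_3122 :: "flavour \<Rightarrow> flavour \<Rightarrow> trace_poly" where
  "table_3122 i j = (let p = phi i; p' = phi (other i); q = phib j; q' = phib (other j) in
    [(2, [[p, q'], [p, q, p, q', p', q]]),
     (2, [[p, q], [p, q', p, q', p', q]]),
     (2, [[p, q], [p, q, p, q', p', q']]),
     (2, [[p, q', p, q, p, q', p', q]]),
     (2, [[p, q, p, q', p, q', p', q]]),
     (2, [[p, q, p, q, p, q', p', q']])])"

definition points_3122 :: "flavour \<Rightarrow> flavour \<Rightarrow> (int \<times> (letter \<Rightarrow> mat2)) list" where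
  "points_3122 i j =
    [(1, point i j [(0, 1, -1, 1), (0, -1, 0, 0), (1, 0, 0, 1), (0, 0, 0, 1), (0, -1, 0, 0), (0, -2, 0, 0), (1, 0, 0, 0), (1, 0, 0, 0)]),
     (-1, point i j [(0, 1, -1, 1), (0, -1, 0, 0), (1, 0, 0, 1), (-2, 0, 0, -1), (0, -1, 0, 0), (0, 0, 0, 0), (1, 0, 0, 0), (1, 0, 0, 0)])]"

definition table_2231 :: "flavour \<Rightarrow> flavour \<Rightarrow> trace_poly" where
  "table_2231 i j = (let p = phi i; p' = phi (other i); q = phib j; q' = phib (other j) in
    [(2, [[p', q], [p, q, p, q', p', q]]),
     (2, [[p, q], [p', q, p, q', p', q]]),
     (2, [[p, q], [p, q, p', q', p', q]]),
     (2, [[p', q, p, q, p, q', p', q]]),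
     (2, [[p, q, p', q, p, q', p', q]]),
     (2, [[p, q, p, q, p', q', p', q]])])"

definition points_2231 :: "flavour \<Rightarrow> flavour \<Rightarrow> (int \<times> (letter \<Rightarrow> mat2)) list" where
  "points_2231 i j =
    [(1, point i j [(0, 1, -1, 1), (0, 0, -1, 1), (1, 0, 0, 1), (-1, 0, 0, 0), (0, -1, 0, 0), (0, -1, 0, 0), (1, 0, 0, 0), (2, 0, 0, 0)]),
     (-1, point i j [(0, 1, -1, 1), (0, -2, 1, -1), (1, 0, 0, 1), (-1, 0, 0, 0), (0, -1, 0, 0), (0, -1, 0, 0), (1, 0, 0, 0), (0, 0, 0, 0)])]"

definition table_2222 :: "flavour \<Rightarrow> flavour \<Rightarrow> trace_poly" where
  "table_2222 i j = (let p = phi i; p' = phi (other i); q = phib j; q' = phib (other j) in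
    [(4, [[p, q], [p, q, p', q'], [p', q']]),
     (-2, [[p, q], [p, q', p', q', p', q]]),
     (-1, [[p, q, p, q, p', q', p', q']]),
     (-2, [[p, q, p, q', p', q], [p', q']]),
     (-1, [[p, q, p, q', p', q', p', q]]),
     (1, [[p, q, p', q, p', q', p, q']]),
     (3, [[p, q, p', q'], [p, q, p', q']]),
     (2, [[p, q, p', q'], [p, q', p', q]]),
     (-1, [[p, q', p, q', p', q, p', q]]),
     (-1, [[p, q', p', q, p, q', p', q]])])"

definition points_2222 :: "flavour \<Rightarrow> flavour \<Rightarrow> (int \<times> (letter \<Rightarrow> mat2)) list" where
  "points_2222 i j =
    [(1, point i j [(1, 0, 1, 1), (0, -1, -1, 0), (1, 0, 0, 1), (0, 1, 1, -1), (0, -1, 0, 0), (0, 0, 1, 1), (0, -1, 0, 1), (-1, 0, 0, 0)])]"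

section \<open>Checking the certificates and detecting the allowed dressings\<close>

definition certifies :: "trace_poly \<Rightarrow> (int \<times> (letter \<Rightarrow> mat2)) list \<Rightarrow> bool" where
  "certifies T pts \<longleftrightarrow> certificate (key_table T) pts (content_of T)"

definition detects :: "trace_poly \<Rightarrow> (int \<times> (letter \<Rightarrow> mat2)) list \<Rightarrow> trace_poly \<Rightarrow> bool" where
  "detects T pts P \<longleftrightarrow> content_size (content_of T) = 8 \<and> list_all (\<lambda>(c, ws). list_all alternating ws) P \<and>
     (\<Sum>(c, ws)\<leftarrow>P. c * point_value pts (content_of T) ws) \<noteq> 0"

lemma detected_not_monotone_exact:
  "certifies T pts \<Longrightarrow> detects T pts P \<Longrightarrow> ev_poly P \<notin> monotone_ops + exact_ops"
  unfolding certifies_def detects_def by (intro certificate_not_monotone_exact) auto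

lemma certifies_3131: "certifies (table_3131 i j) (points_3131 i j)"
proof -
  have "certifies (table_3131 F1 F1) (points_3131 F1 F1)" by code_simp
  moreover have "certifies (table_3131 F1 F2) (points_3131 F1 F2)" by code_simp
  moreover have "certifies (table_3131 F2 F1) (points_3131 F2 F1)" by code_simp
  moreover have "certifies (table_3131 F2 F2) (points_3131 F2 F2)" by code_simp
  ultimately show ?thesis by (cases i; cases j) simp_all
qed

text \<open>Both flavours of \<open>phib\<close> occur twice, so the content does not depend on
  \<open>j\<close> and one choice is enough. In \<open>certifies_2231\<close> the same holds for
  \<open>phi\<close> and \<open>i\<close>.\<close>

lemma certifies_3122: "certifies (table_3122 i F1) (points_3122 i F1)"
proof -
  have "certifies (table_3122 F1 F1) (points_3122 F1 F1)" by code_simp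
  moreover have "certifies (table_3122 F2 F1) (points_3122 F2 F1)" by code_simp
  ultimately show ?thesis by (cases i) simp_all
qed

lemma certifies_2231: "certifies (table_2231 F1 j) (points_2231 F1 j)"
proof -
  have "certifies (table_2231 F1 F1) (points_2231 F1 F1)" by code_simp
  moreover have "certifies (table_2231 F1 F2) (points_2231 F1 F2)" by code_simp
  ultimately show ?thesis by (cases j) simp_all
qed

lemma certifies_2222: "certifies (table_2222 F1 F1) (points_2222 F1 F1)"
  by code_simp

lemma singlet_allowed: "ev_poly singlet \<notin> monotone_ops + exact_ops"
proof -
  have "detects (table_2222 F1 F1) (points_2222 F1 F1) singlet" by code_simp
  with certifies_2222 show ?thesis by (rule detected_not_monotone_exact)
qed

text \<open>The content depends on whether \<open>c = a\<close> and whether \<open>d = b\<close>,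
  which selects one of the four certificates. When both pairs differ, the functional is the one that
  also detects the singlet.\<close>

lemma bitriplet_allowed: "ev_poly (bitriplet a b c d) \<notin> monotone_ops + exact_ops"
proof -
  have "list_all (\<lambda>a. list_all (\<lambda>b. detects (table_3131 b a) (points_3131 b a) (bitriplet a b a b) \<and>
      detects (table_2231 F1 a) (points_2231 F1 a) (bitriplet a b a (other b)) \<and>
      detects (table_3122 b F1) (points_3122 b F1) (bitriplet a b (other a) b) \<and>
      detects (table_2222 F1 F1) (points_2222 F1 F1) (bitriplet a b (other a) (other b))) [F1, F2]) [F1, F2]"
    by code_simp
  then have "detects (table_3131 b a) (points_3131 b a) (bitriplet a b a b) \<and>
      detects (table_2231 F1 a) (points_2231 F1 a) (bitriplet a b a (other b)) \<and>
      detects (table_3122 b F1) (points_3122 b F1) (bitriplet a b (other a) b) \<and>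
      detects (table_2222 F1 F1) (points_2222 F1 F1) (bitriplet a b (other a) (other b))"
    by (cases a; cases b) (simp_all only: list.pred_inject simp_thms)
  moreover have "c = a \<or> c = other a" "d = b \<or> d = other b" by (cases a; cases b; cases c; cases d; simp)+
  ultimately show ?thesis
    using detected_not_monotone_exact certifies_3131 certifies_3122 certifies_2231 certifies_2222
    by metis
qed

theorem mainTheorem1:
  "(\<forall>b d. (\<Sum>a\<in>UNIV. \<Sum>c\<in>UNIV. eps a c * (O_op a b * T_op c d + O_op a d * T_op c b))
        \<in> monotone_ops + exact_ops)
   \<and> (\<forall>a c. (\<Sum>b\<in>UNIV. \<Sum>d\<in>UNIV. eps b d * (O_op a b * T_op c d + O_op c b * T_op a d))
        \<in> monotone_ops + exact_ops)
   \<and> (\<Sum>a\<in>UNIV. \<Sum>c\<in>UNIV. \<Sum>b\<in>UNIV. \<Sum>d\<in>UNIV. eps a c * eps b d * (O_op a b * T_op c d))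
        \<notin> monotone_ops + exact_ops
   \<and> (\<forall>a b c d. O_op a b * T_op c d + O_op c b * T_op a d + O_op a d * T_op c b + O_op c d * T_op a b
        \<notin> monotone_ops + exact_ops)"
  using lower_dressing_disallowed upper_dressing_disallowed singlet_allowed bitriplet_allowed
  unfolding ev_lower_dressing ev_upper_dressing ev_singlet ev_bitriplet by blast

end
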